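(* Let $F=(f_1,\ldots,f_n)^T$ be a polynomial system with $f_i\in\mathbb{K}[x_1,\ldots,x_n]$. Suppose $\hat{\mathbf{x}}\in\mathbb{K}^n$ is an exact isolated root of $F(\mathbf{x})=0$ with multiplicity $\mu$, and the corank of $J_F(\hat{\mathbf{x}})$ is exactly one. Assume that the first row of $J_F(\hat{\mathbf{x}})$ is a linear combination of its other rows and that the first column of $J_F(\hat{\mathbf{x}})$ is a linear combination of its other columns. Let $\tilde{J}_F(\hat{\mathbf{x}})$ be the $n\times(n-1)$ matrix consisting of the last $n-1$ columns of $J_F(\hat{\mathbf{x}})$, and let $\mathbf{e}_1=(1,0,\ldots,0)^T\in\mathbb{K}^n$. Then $$\mathrm{rank}\left(\tilde{J}_F(\hat{\mathbf{x}}),\mathbf{e}_1\right)=n .$$ Moreover, with $G(\mathbf{x},\mathbf{b},\mathbf{a})$ the deflated system associated with $F$ and $\mu$ (defined in the context), evaluated at $\hat{\mathbf{b}}=\mathbf{0}$ (i.e. with no perturbation of $F$) and with $\hat{\mathbf{a}}$ the parameter values satisfying $G(\hat{\mathbf{x}},\mathbf{0},\hat{\mathbf{a}})=0$, the Jacobian matrix $J_G(\hat{\mathbf{x}},\mathbf{0},\hat{\mathbf{a}})$ is nonsingular.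
   Context: $\mathbb{K}$ is a field of characteristic zero and $\mathbf{x}=(x_1,\ldots,x_n)$. The corank of an $n\times n$ matrix is $n$ minus its rank. The multiplicity $\mu$ of an isolated root $\hat{\mathbf{x}}\in\mathbb{K}^n$ of a system $F=\{f_1,\ldots,f_n\}$ is $\dim_{\mathbb{K}}\mathbb{K}[\mathbf{x}]/Q_{\hat{\mathbf{x}}}$, where $Q_{\hat{\mathbf{x}}}$ is the isolated primary component of the ideal $(f_1,\ldots,f_n)$ whose associated prime is $(x_1-\hat{x}_1,\ldots,x_n-\hat{x}_n)$. (Here $\mu\ge 2$ since the Jacobian is singular.) Deflated system. Introduce smoothing parameters $\mathbf{b}=[b_0,b_1,\ldots,b_{\mu-2}]$ and parameters $\mathbf{a}=[\mathbf{a}_2,\ldots,\mathbf{a}_\mu]$ with $\mathbf{a}_2=[1,a_{2,2},\ldots,a_{2,n}]^T$ and $\mathbf{a}_k=[0,a_{k,2},\ldots,a_{k,n}]^T$ for $2<k\le\mu$; the unknowns are the $a_{k,j}$, $2\le k\le\mu$, $2\le j\le n$. Let $$F_1(\mathbf{x},\mathbf{b})=F(\mathbf{x})-\left(\sum_{\nu=0}^{\mu-2}\frac{b_\nu x_1^\nu}{\nu!}\right)\mathbf{e}_1 .$$ For a system $H$ of $n$ polynomials let $J_H$ denote its $n\times n$ Jacobian matrix with respect to $\mathbf{x}$ (all $a_{k,j}$ and $b_\nu$ treated as constants), and define recursively $L_2(H)=J_H\cdot\mathbf{a}_2$ and, for $k\ge 3$, $$P_k(H)=\sum_{j=1}^{k-2}\frac{j}{k-1}\,J_{L_{k-j}(H)}\cdot\mathbf{a}_{j+1},\qquad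 L_k(H)=P_k(H)+J_H\cdot\mathbf{a}_k .$$ Put $F_k(\mathbf{x},\mathbf{b},\mathbf{a}_2,\ldots,\mathbf{a}_k)=L_k(F_1)$ for $2\le k\le\mu$, and $$G(\mathbf{x},\mathbf{b},\mathbf{a})=\begin{pmatrix}F_1(\mathbf{x},\mathbf{b})\\ F_2(\mathbf{x},\mathbf{b},\mathbf{a}_2)\\ \vdots\\ F_\mu(\mathbf{x},\mathbf{b},\mathbf{a}_2,\ldots,\mathbf{a}_\mu)\end{pmatrix},$$ a system of $\mu n$ equations in $\mu n$ variables. $J_G$ denotes the $\mu n\times\mu n$ Jacobian matrix of $G$ with respect to all variables $(\mathbf{x},\mathbf{b},\mathbf{a})$ (that is, $x_1,\ldots,x_n$, $b_0,\ldots,b_{\mu-2}$, and the $a_{k,j}$). *)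

theory Defs
  imports
    "HOL-Library.Poly_Mapping"
    "HOL-Library.FuncSet"
    "HOL-Algebra.QuotRing"
    "HOL-Algebra.Embedded_Algebras"
    "Jordan_Normal_Form.DL_Rank"
begin

section \<open>Multivariate polynomials\<close>

text \<open>Polynomials over \<open>'a\<close> in indeterminates from \<open>'v\<close>: finitely supported maps from
  exponent vectors to coefficients, with the ring structure of \<^theory>\<open>HOL-Library.Poly_Mapping\<close>.\<close>

type_synonym ('v, 'a) mpoly = "('v \<Rightarrow>\<^sub>0 nat) \<Rightarrow>\<^sub>0 'a"

definition mConst :: "'a \<Rightarrow> ('v, 'a::zero) mpoly" where
  "mConst c = Poly_Mapping.single 0 c"

definition mVar :: "'v \<Rightarrow> ('v, 'a::zero_neq_one) mpoly" where
  "mVar v = Poly_Mapping.single (Poly_Mapping.single v 1) 1"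

definition indets :: "('v, 'a::zero) mpoly \<Rightarrow> 'v set" where
  "indets p = (\<Union>m \<in> Poly_Mapping.keys p. Poly_Mapping.keys m)"

definition meval :: "('v \<Rightarrow> 'a) \<Rightarrow> ('v, 'a::comm_semiring_1) mpoly \<Rightarrow> 'a" where
  "meval pt p = (\<Sum>m \<in> Poly_Mapping.keys p.
     Poly_Mapping.lookup p m * (\<Prod>v \<in> Poly_Mapping.keys m. pt v ^ Poly_Mapping.lookup m v))"

text \<open>Formal partial derivative. The subtraction of exponents truncates, but only in terms
  whose coefficient vanishes.\<close>

definition mderiv :: "'v \<Rightarrow> ('v, 'a::comm_semiring_1) mpoly \<Rightarrow> ('v, 'a) mpoly" where
  "mderiv v p = (\<Sum>m \<in> Poly_Mapping.keys p.
     Poly_Mapping.single (m - Poly_Mapping.single v 1)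
       (of_nat (Poly_Mapping.lookup m v) * Poly_Mapping.lookup p m))"

definition mpoly_ring :: "'v set \<Rightarrow> ('v, 'a::comm_ring_1) mpoly ring" where
  "mpoly_ring V = \<lparr>carrier = {p. indets p \<subseteq> V}, mult = (*), one = 1, zero = 0, add = (+)\<rparr>"


section \<open>Isolated primary components\<close>

definition radical :: "('r, 'm) ring_scheme \<Rightarrow> 'r set \<Rightarrow> 'r set" where
  "radical R I = {r \<in> carrier R. \<exists>k::nat. r [^]\<^bsub>R\<^esub> k \<in> I}"

definition primary_ideal :: "('r, 'm) ring_scheme \<Rightarrow> 'r set \<Rightarrow> bool" where
  "primary_ideal R Q \<longleftrightarrow> ideal Q R \<and> Q \<noteq> carrier R \<and>
     (\<forall>a \<in> carrier R. \<forall>b \<in> carrier R. a \<otimes>\<^bsub>R\<^esub> b \<in> Q \<longrightarrow> a \<in> Q \<or> b \<in> radical R Q)"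

text \<open>Irredundant primary decomposition of \<open>I\<close>, with pairwise distinct associated primes.\<close>

definition primary_decomposition :: "('r, 'm) ring_scheme \<Rightarrow> 'r set \<Rightarrow> 'r set set \<Rightarrow> bool" where
  "primary_decomposition R I D \<longleftrightarrow>
     finite D \<and> (\<forall>Q \<in> D. primary_ideal R Q) \<and> carrier R \<inter> \<Inter>D = I \<and>
     inj_on (radical R) D \<and> (\<forall>Q \<in> D. carrier R \<inter> \<Inter>(D - {Q}) \<noteq> I)"

text \<open>\<open>Q\<close> is the component belonging to the associated prime \<open>P\<close> of \<open>I\<close>, and \<open>P\<close> is
  isolated, i.e. minimal among the associated primes.\<close>

definition isolated_primary_component ::
    "('r, 'm) ring_scheme \<Rightarrow> 'r set \<Rightarrow> 'r set \<Rightarrow> 'r set \<Rightarrow> bool" where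
  "isolated_primary_component R I P Q \<longleftrightarrow>
     (\<exists>D. primary_decomposition R I D \<and> Q \<in> D \<and> radical R Q = P \<and>
          (\<forall>Q' \<in> D. \<not> radical R Q' \<subset> P))"


section \<open>Polynomial systems and multiplicities of isolated roots\<close>

text \<open>Coordinates are numbered from 0: \<open>X i\<close> stands for $x_{i+1}$ and \<open>A k j\<close> for
  $a_{k,j+1}$. The index \<open>k\<close> and the index of \<open>B \<nu>\<close> ($b_\nu$) are the usual ones.\<close>

datatype pvar = X nat | B nat | A nat nat

type_synonym 'a pvpoly = "(pvar, 'a) mpoly"

fun point :: "'a vec \<Rightarrow> (nat \<Rightarrow> 'a) \<Rightarrow> (nat \<times> nat \<Rightarrow> 'a) \<Rightarrow> pvar \<Rightarrow> 'a" where
  "point x b a (X i) = x $ i"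
| "point x b a (B \<nu>) = b \<nu>"
| "point x b a (A k j) = a (k, j)"

abbreviation xpoint :: "'a::zero vec \<Rightarrow> pvar \<Rightarrow> 'a" where
  "xpoint x \<equiv> point x (\<lambda>_. 0) (\<lambda>_. 0)"

definition xring :: "nat \<Rightarrow> 'a::comm_ring_1 pvpoly ring" where
  "xring n = mpoly_ring (X ` {..<n})"

definition system_ideal :: "nat \<Rightarrow> 'a::comm_ring_1 pvpoly vec \<Rightarrow> 'a pvpoly set" where
  "system_ideal n F = Idl\<^bsub>xring n\<^esub> {F $ i | i. i < n}"

definition point_ideal :: "nat \<Rightarrow> 'a::comm_ring_1 vec \<Rightarrow> 'a pvpoly set" where
  "point_ideal n x = Idl\<^bsub>xring n\<^esub> {mVar (X i) - mConst (x $ i) | i. i < n}"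

text \<open>\<open>K\<close>-dimension of $K[x_1,\ldots,x_n]/Q$, the field being embedded by the cosets of the
  constants.\<close>

definition quotient_dim :: "nat \<Rightarrow> 'a::comm_ring_1 pvpoly set \<Rightarrow> nat \<Rightarrow> bool" where
  "quotient_dim n Q d \<longleftrightarrow>
     ring.dimension (xring n Quot Q) d (range (\<lambda>c. Q +>\<^bsub>xring n\<^esub> mConst c))
       (carrier (xring n Quot Q))"

text \<open>\<open>x\<close> is an isolated root of multiplicity \<open>\<mu>\<close>. Over an arbitrary field, ``isolated'' means that
  the maximal ideal of \<open>x\<close> is an isolated associated prime of the system, as required for the
  component defining the multiplicity to exist.\<close>

definition isolated_root_mult ::
    "nat \<Rightarrow> 'a::field_char_0 pvpoly vec \<Rightarrow> 'a vec \<Rightarrow> nat \<Rightarrow> bool" where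
  "isolated_root_mult n F x \<mu> \<longleftrightarrow>
     (\<forall>i<n. meval (xpoint x) (F $ i) = 0) \<and>
     (\<exists>Q. isolated_primary_component (xring n) (system_ideal n F) (point_ideal n x) Q \<and>
          quotient_dim n Q \<mu>)"


section \<open>Jacobian matrices and the deflated system\<close>

definition jacobian :: "nat \<Rightarrow> 'a::comm_ring_1 pvpoly vec \<Rightarrow> 'a pvpoly mat" where
  "jacobian n H = mat n n (\<lambda>(i, j). mderiv (X j) (H $ i))"

definition jacobian_at :: "nat \<Rightarrow> 'a::comm_ring_1 pvpoly vec \<Rightarrow> 'a vec \<Rightarrow> 'a mat" where
  "jacobian_at n F x = map_mat (meval (xpoint x)) (jacobian n F)"

definition corank :: "'a::field mat \<Rightarrow> nat" where
  "corank M = dim_row M - vec_space.rank (dim_row M) M"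

definition avec :: "nat \<Rightarrow> nat \<Rightarrow> 'a::comm_ring_1 pvpoly vec" where
  "avec n k = vec n (\<lambda>j. if j = 0 then (if k = 2 then 1 else 0) else mVar (A k j))"

definition perturbed :: "nat \<Rightarrow> nat \<Rightarrow> 'a::field_char_0 pvpoly vec \<Rightarrow> 'a pvpoly vec" where
  "perturbed n \<mu> F = F -
     (\<Sum>\<nu><\<mu> - 1. mConst (1 / fact \<nu>) * mVar (B \<nu>) * mVar (X 0) ^ \<nu>) \<cdot>\<^sub>v unit_vec n 0"

text \<open>\<open>Lop n H k\<close> is $L_k(H)$ for \<open>k \<ge> 2\<close>; the inner vector is $P_k(H)$.\<close>

function Lop :: "nat \<Rightarrow> 'a::field_char_0 pvpoly vec \<Rightarrow> nat \<Rightarrow> 'a pvpoly vec" where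
  "Lop n H k =
     (if k \<le> 2 then jacobian n H *\<^sub>v avec n 2
      else vec n (\<lambda>i. \<Sum>j \<in> {1..k-2}.
             mConst (of_nat j / of_nat (k-1)) *
             (jacobian n (Lop n H (k-j)) *\<^sub>v avec n (j+1)) $ i)
           + jacobian n H *\<^sub>v avec n k)"
  by pat_completeness auto
termination
  by (relation "measure (\<lambda>(n, H, k). k)") auto

declare Lop.simps [simp del]

definition deflated_block ::
    "nat \<Rightarrow> nat \<Rightarrow> 'a::field_char_0 pvpoly vec \<Rightarrow> nat \<Rightarrow> 'a pvpoly vec" where
  "deflated_block n \<mu> F k =
     (if k = 1 then perturbed n \<mu> F else Lop n (perturbed n \<mu> F) k)"

definition deflated :: "nat \<Rightarrow> nat \<Rightarrow> 'a::field_char_0 pvpoly vec \<Rightarrow> 'a pvpoly vec" where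
  "deflated n \<mu> F = vec (\<mu> * n) (\<lambda>r. deflated_block n \<mu> F (r div n + 1) $ (r mod n))"

text \<open>The \<open>\<mu>n\<close> variables of the deflated system, in the order \<open>(x, b, a)\<close>.\<close>

definition deflated_vars :: "nat \<Rightarrow> nat \<Rightarrow> pvar list" where
  "deflated_vars n \<mu> =
     map X [0..<n] @ map B [0..<\<mu> - 1] @
     concat (map (\<lambda>k. map (A k) [1..<n]) [2..<\<mu> + 1])"

definition deflated_jacobian :: "nat \<Rightarrow> nat \<Rightarrow> 'a::field_char_0 pvpoly vec \<Rightarrow> 'a pvpoly mat" where
  "deflated_jacobian n \<mu> F =
     mat (\<mu> * n) (\<mu> * n) (\<lambda>(r, c). mderiv (deflated_vars n \<mu> ! c) (deflated n \<mu> F $ r))"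

text \<open>Values of the unknowns $a_{k,j}$ as functions on exactly the index set of these unknowns
  (second index numbered from 0), so that uniqueness is meaningful.\<close>

definition a_values :: "nat \<Rightarrow> nat \<Rightarrow> (nat \<times> nat \<Rightarrow> 'a) set" where
  "a_values n \<mu> = ({2..\<mu>} \<times> {1..<n}) \<rightarrow>\<^sub>E UNIV"

definition deflated_root ::
    "nat \<Rightarrow> nat \<Rightarrow> 'a::field_char_0 pvpoly vec \<Rightarrow> 'a vec \<Rightarrow> (nat \<Rightarrow> 'a) \<Rightarrow> (nat \<times> nat \<Rightarrow> 'a) \<Rightarrow> bool"
  where
  "deflated_root n \<mu> F x b a \<longleftrightarrow> map_vec (meval (point x b a)) (deflated n \<mu> F) = 0\<^sub>v (\<mu> * n)"

end

theory Submission
  imports Defs "HOL-Computational_Algebra.Polynomial_FPS"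
begin

text \<open>
  The unknowns of the deflated system are the coefficients of a formal arc
  $x(t) = x + a_2 t + a_3 t^2 + \cdots$, whose first coordinate is $x_1 + t$ by the shape of
  $a_2, a_3, \ldots$ Differentiating $H(x(t))$ with respect to $t$ and comparing coefficients
  reproduces the recursion for $L_k$, so $L_k(H)$ is the coefficient of $t^{k-1}$ in $H(x(t))$
  (lemma \<open>Lop_eq_along_arc\<close>). Hence $G = 0$ says that
  $F(x(t)) - \sum_\nu b_\nu (x_1+t)^\nu/\nu! \cdot e_1$ vanishes modulo $t^\mu$.

  Corank one and the two dependence hypotheses make the block $M$ of the Jacobian at $\hat x$
  without its first row and first column invertible (\<open>corank1_lower_block\<close>); this gives the
  statement about the rank. It also means that $f_2 = \cdots = f_n = 0$ can be solved, coefficient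
  by coefficient and uniquely, by an arc through $\hat x$ with first coordinate $\hat x_1 + t$
  (\<open>exists_approximate_arc\<close>, \<open>pull_lower_unique\<close>).

  The multiplicity enters as follows. Let $Q$ be the primary component at $\hat x$ and
  $\tau = x_1 - \hat x_1$. By Cramer's rule, every coordinate function agrees modulo $Q$ with the
  corresponding coordinate of the arc at $t = \tau$ (\<open>arc_residue_in_Q\<close>). Hence the quotient
  by $Q$ has the basis $1, \tau, \ldots, \tau^{\mu-1}$ (\<open>dimension_quotient\<close>), and $f_1$ vanishes
  along the arc to order exactly $\mu$ (\<open>exists_arc_of_order_nil_index\<close>). So the arc solves
  $G = 0$ at $b = 0$, and it is the only solution.

  Finally, a kernel vector of $J_G$ is a first order variation $v(t)$ of the arc together with a
  variation of $b$, satisfying $J_F(x(t))\, v(t) \equiv S(t)\, e_1$ modulo $t^\mu$, where $S$ is a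
  polynomial of degree at most $\mu - 2$. Since $J_F(x(t))\, x'(t)$ is the derivative of
  $F(x(t))$, subtracting the multiple $v_1 x'(t)$ leaves a vector with vanishing first coordinate,
  which is zero because $M$ is invertible. The coefficient of $t^{\mu-1}$ in the first equation now
  gives $v_1 = 0$, because $f_1(x(t))$ has order exactly $\mu$, and then everything vanishes
  (\<open>linearized_system_trivial\<close>).
\<close>

section \<open>Substitution into multivariate polynomials and partial derivatives\<close>

definition monom_val :: "('v \<Rightarrow> 'b::comm_semiring_1) \<Rightarrow> ('v \<Rightarrow>\<^sub>0 nat) \<Rightarrow> 'b" where
  "monom_val pt m = (\<Prod>v \<in> Poly_Mapping.keys m. pt v ^ Poly_Mapping.lookup m v)"

text \<open>Evaluation with values in another ring, coefficients being mapped by \<open>c\<close>. Taking power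
  series or polynomials as values turns it into restriction to an arc.\<close>

definition mpoly_subst ::
    "('a \<Rightarrow> 'b) \<Rightarrow> ('v \<Rightarrow> 'b) \<Rightarrow> ('v, 'a::zero) mpoly \<Rightarrow> 'b::comm_semiring_1" where
  "mpoly_subst c pt p =
     (\<Sum>m \<in> Poly_Mapping.keys p. c (Poly_Mapping.lookup p m) * monom_val pt m)"

lemma meval_eq_mpoly_subst: "meval pt = mpoly_subst (\<lambda>c. c) pt"
  by (simp add: fun_eq_iff meval_def mpoly_subst_def monom_val_def)

lemma monom_val_superset:
  assumes "finite S" "Poly_Mapping.keys m \<subseteq> S"
  shows "monom_val pt m = (\<Prod>v \<in> S. pt v ^ Poly_Mapping.lookup m v)"
  unfolding monom_val_def
  by (rule prod.mono_neutral_left) (use assms in \<open>auto simp: in_keys_iff\<close>)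

lemma monom_val_add: "monom_val pt (m + m') = monom_val pt m * monom_val pt m'"
proof -
  let ?S = "Poly_Mapping.keys m \<union> Poly_Mapping.keys m'"
  have "Poly_Mapping.keys (m + m') \<subseteq> ?S" by (rule keys_add)
  then show ?thesis
    using monom_val_superset[of ?S m pt] monom_val_superset[of ?S m' pt]
      monom_val_superset[of ?S "m + m'" pt]
    by (simp add: lookup_add power_add prod.distrib)
qed

lemma mpoly_sum_monomials:
  "p = (\<Sum>m \<in> Poly_Mapping.keys p. Poly_Mapping.single m (Poly_Mapping.lookup p m))"
  for p :: "('v, 'a::comm_monoid_add) mpoly"
  by (rule poly_mapping_eqI)
     (auto simp: lookup_sum lookup_single when_def in_keys_iff)

lemma single_eq_mConst_mult_mVars:
  "Poly_Mapping.single m c =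
     mConst c * (\<Prod>v \<in> Poly_Mapping.keys m. mVar v ^ Poly_Mapping.lookup m v)"
  for c :: "'a::comm_semiring_1"
proof -
  have pow: "mVar v ^ k = Poly_Mapping.single (Poly_Mapping.single v k) (1::'a)" for v :: 'b and k
    by (induction k) (simp_all add: mVar_def mult_single flip: single_add)
  have "(\<Prod>v \<in> S. mVar v ^ Poly_Mapping.lookup m v)
      = Poly_Mapping.single (\<Sum>v \<in> S. Poly_Mapping.single v (Poly_Mapping.lookup m v)) (1::'a)"
    if "finite S" for S
    using that by induction (simp_all add: pow mult_single)
  moreover have "(\<Sum>v \<in> Poly_Mapping.keys m. Poly_Mapping.single v (Poly_Mapping.lookup m v)) = m"
    by (rule poly_mapping_eqI)
       (auto simp: lookup_sum lookup_single when_def in_keys_iff)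
  ultimately show ?thesis by (simp add: mConst_def mult_single)
qed

lemma indets_mConst [simp]: "indets (mConst c) = {}"
  by (simp add: indets_def mConst_def)

lemma indets_mVar [simp]: "indets (mVar v :: ('v, 'a::zero_neq_one) mpoly) = {v}"
  by (simp add: indets_def mVar_def)

lemma indets_0 [simp]: "indets 0 = {}" and indets_1 [simp]: "indets 1 = {}"
  by (simp_all add: indets_def)

lemma indets_add: "indets (p + q) \<subseteq> indets p \<union> indets q"
  for p q :: "('v, 'a::comm_semiring_1) mpoly"
  using keys_add[of p q] by (auto simp: indets_def)

lemma indets_uminus [simp]: "indets (- p) = indets p" for p :: "('v, 'a::comm_ring_1) mpoly"
  by (simp add: indets_def keys_def)

lemma indets_diff: "indets (p - q) \<subseteq> indets p \<union> indets q"
  for p q :: "('v, 'a::comm_ring_1) mpoly"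
  using indets_add[of p "- q"] by simp

lemma indets_mult: "indets (p * q) \<subseteq> indets p \<union> indets q"
  for p q :: "('v, 'a::comm_semiring_1) mpoly"
proof
  fix v assume "v \<in> indets (p * q)"
  then obtain m where m: "m \<in> Poly_Mapping.keys (p * q)" "v \<in> Poly_Mapping.keys m"
    by (auto simp: indets_def)
  then obtain a b where "a \<in> Poly_Mapping.keys p" "b \<in> Poly_Mapping.keys q" "m = a + b"
    using keys_mult[of p q] by blast
  moreover from this m(2) have "v \<in> Poly_Mapping.keys a \<union> Poly_Mapping.keys b"
    using keys_add[of a b] by blast
  ultimately show "v \<in> indets p \<union> indets q" by (auto simp: indets_def)
qed

lemma indets_sum: "(\<And>i. i \<in> I \<Longrightarrow> indets (f i) \<subseteq> V) \<Longrightarrow> indets (sum f I) \<subseteq> V"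
  for f :: "'i \<Rightarrow> ('v, 'a::comm_semiring_1) mpoly"
proof (induction I rule: infinite_finite_induct)
  case (insert i I)
  then show ?case using indets_add[of "f i" "sum f I"] by (simp, blast)
qed simp_all

lemma indets_prod: "(\<And>i. i \<in> I \<Longrightarrow> indets (f i) \<subseteq> V) \<Longrightarrow> indets (prod f I) \<subseteq> V"
  for f :: "'i \<Rightarrow> ('v, 'a::comm_semiring_1) mpoly"
proof (induction I rule: infinite_finite_induct)
  case (insert i I)
  then show ?case using indets_mult[of "f i" "prod f I"] by (simp, blast)
qed simp_all

lemma indets_power: "indets p \<subseteq> V \<Longrightarrow> indets (p ^ k) \<subseteq> V"
  for p :: "('v, 'a::comm_semiring_1) mpoly"
  using indets_prod[of "{..<k}" "\<lambda>_. p" V] by simp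

lemma mpoly_induct [consumes 1, case_names const var add mult]:
  fixes p :: "('v, 'a::comm_semiring_1) mpoly"
  assumes p: "indets p \<subseteq> V"
    and const: "\<And>c. P (mConst c)"
    and var: "\<And>v. v \<in> V \<Longrightarrow> P (mVar v)"
    and add: "\<And>p q. indets p \<subseteq> V \<Longrightarrow> indets q \<subseteq> V \<Longrightarrow> P p \<Longrightarrow> P q \<Longrightarrow> P (p + q)"
    and mult: "\<And>p q. indets p \<subseteq> V \<Longrightarrow> indets q \<subseteq> V \<Longrightarrow> P p \<Longrightarrow> P q \<Longrightarrow> P (p * q)"
  shows "P p"
proof -
  define Q where "Q = (\<lambda>p. indets p \<subseteq> V \<and> P p)"
  have Qmult: "Q (p * q)" if "Q p" "Q q" for p q
    using that mult indets_mult[of p q] unfolding Q_def by blast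
  have Qadd: "Q (p + q)" if "Q p" "Q q" for p q
    using that add indets_add[of p q] unfolding Q_def by blast
  have Qc: "Q (mConst c)" for c using const by (simp add: Q_def)
  have Q01: "Q 0" "Q 1" using Qc[of 0] Qc[of 1] by (simp_all add: mConst_def)
  have Qpow: "Q (mVar v ^ k)" if "v \<in> V" for v k
  proof (induction k)
    case (Suc k)
    have "Q (mVar v)" using that var by (simp add: Q_def)
    then show ?case using Suc Qmult by simp
  qed (simp add: Q01)
  have Qprod: "Q (prod f S)" if "\<And>v. v \<in> S \<Longrightarrow> Q (f v)" for f :: "'v \<Rightarrow> _" and S
    using that by (induction S rule: infinite_finite_induct) (auto simp: Q01 Qmult)
  have Qsum: "Q (sum f S)" if "\<And>v. v \<in> S \<Longrightarrow> Q (f v)" for f :: "('v \<Rightarrow>\<^sub>0 nat) \<Rightarrow> _" and S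
    using that by (induction S rule: infinite_finite_induct) (auto simp: Q01 Qadd)
  have "Q (\<Sum>m \<in> Poly_Mapping.keys p. Poly_Mapping.single m (Poly_Mapping.lookup p m))"
    using p by (intro Qsum) (auto simp: single_eq_mConst_mult_mVars indets_def intro!: Qmult Qc Qprod Qpow)
  then show ?thesis
    using mpoly_sum_monomials[of p] by (simp add: Q_def)
qed

lemma mpoly_subst_superset:
  assumes "finite S" "Poly_Mapping.keys p \<subseteq> S" "c 0 = 0"
  shows "mpoly_subst c pt p = (\<Sum>m \<in> S. c (Poly_Mapping.lookup p m) * monom_val pt m)"
  unfolding mpoly_subst_def
  by (rule sum.mono_neutral_left) (use assms in \<open>auto simp: in_keys_iff\<close>)

context comm_ring_hom
begin

lemma mpoly_subst_single: "mpoly_subst hom pt (Poly_Mapping.single m c) = hom c * monom_val pt m"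
  by (simp add: mpoly_subst_def)

lemma mpoly_subst_mConst [simp]: "mpoly_subst hom pt (mConst c) = hom c"
  by (simp add: mConst_def mpoly_subst_single) (simp add: monom_val_def)

lemma mpoly_subst_mVar [simp]: "mpoly_subst hom pt (mVar v) = pt v"
  by (simp add: mVar_def mpoly_subst_single) (simp add: monom_val_def)

lemma mpoly_subst_add: "mpoly_subst hom pt (p + q) = mpoly_subst hom pt p + mpoly_subst hom pt q"
proof -
  let ?S = "Poly_Mapping.keys p \<union> Poly_Mapping.keys q"
  have "Poly_Mapping.keys (p + q) \<subseteq> ?S" by (rule keys_add)
  then show ?thesis
    using mpoly_subst_superset[of ?S p hom pt] mpoly_subst_superset[of ?S q hom pt]
      mpoly_subst_superset[of ?S "p + q" hom pt]
    by (simp add: lookup_add hom_add ring_distribs sum.distrib)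
qed

lemma mpoly_subst_0: "mpoly_subst hom pt 0 = 0"
  by (simp add: mpoly_subst_def)

lemma mpoly_subst_sum: "mpoly_subst hom pt (sum f I) = (\<Sum>i\<in>I. mpoly_subst hom pt (f i))"
  by (induction I rule: infinite_finite_induct) (simp_all add: mpoly_subst_0 mpoly_subst_add)

lemma mpoly_subst_mult: "mpoly_subst hom pt (p * q) = mpoly_subst hom pt p * mpoly_subst hom pt q"
proof -
  have "p * q = (\<Sum>m \<in> Poly_Mapping.keys p. \<Sum>m' \<in> Poly_Mapping.keys q.
      Poly_Mapping.single (m + m') (Poly_Mapping.lookup p m * Poly_Mapping.lookup q m'))"
    by (subst (1) mpoly_sum_monomials[of p], subst (1) mpoly_sum_monomials[of q])
       (simp add: sum_product mult_single)
  then show ?thesis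
    by (simp add: mpoly_subst_sum mpoly_subst_single hom_mult monom_val_add
        mpoly_subst_def[of hom pt p] mpoly_subst_def[of hom pt q] sum_product mult.assoc mult.left_commute)
qed

lemma comm_ring_hom_mpoly_subst: "comm_ring_hom (mpoly_subst hom pt)"
proof
  have "mpoly_subst hom pt (mConst 1) = 1" by (simp only: mpoly_subst_mConst hom_one)
  then show "mpoly_subst hom pt 1 = 1" by (simp add: mConst_def)
qed (simp_all add: mpoly_subst_0 mpoly_subst_add mpoly_subst_mult)

end

lemma mderiv_superset:
  assumes "finite S" "Poly_Mapping.keys p \<subseteq> S"
  shows "mderiv v p = (\<Sum>m \<in> S. Poly_Mapping.single (m - Poly_Mapping.single v 1)
       (of_nat (Poly_Mapping.lookup m v) * Poly_Mapping.lookup p m))"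
  unfolding mderiv_def
  by (rule sum.mono_neutral_left) (use assms in \<open>auto simp: in_keys_iff\<close>)

lemma mderiv_single: "mderiv v (Poly_Mapping.single m c) =
    Poly_Mapping.single (m - Poly_Mapping.single v 1) (of_nat (Poly_Mapping.lookup m v) * c)"
  by (simp add: mderiv_def)

lemma mderiv_0 [simp]: "mderiv v 0 = 0"
  by (simp add: mderiv_def)

lemma mderiv_mConst [simp]: "mderiv v (mConst c) = 0"
  by (simp add: mConst_def mderiv_single)

lemma mderiv_1 [simp]: "mderiv v 1 = 0"
  using mderiv_mConst[of v 1] by (simp add: mConst_def)

lemma mderiv_mVar: "mderiv v (mVar w) = (if v = w then 1 else 0)"
  by (simp add: mVar_def mderiv_single lookup_single when_def)

lemma mderiv_add: "mderiv v (p + q) = mderiv v p + mderiv v q"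
proof -
  let ?S = "Poly_Mapping.keys p \<union> Poly_Mapping.keys q"
  have "Poly_Mapping.keys (p + q) \<subseteq> ?S" by (rule keys_add)
  then show ?thesis
    using mderiv_superset[of ?S p v] mderiv_superset[of ?S q v] mderiv_superset[of ?S "p + q" v]
    by (simp add: lookup_add ring_distribs sum.distrib single_add)
qed

lemma mderiv_sum: "mderiv v (sum f I) = (\<Sum>i\<in>I. mderiv v (f i))"
  by (induction I rule: infinite_finite_induct) (simp_all add: mderiv_add)

lemma mderiv_single_mult:
  "mderiv v (Poly_Mapping.single m c * Poly_Mapping.single m' c') =
     mderiv v (Poly_Mapping.single m c) * Poly_Mapping.single m' c'
     + Poly_Mapping.single m c * mderiv v (Poly_Mapping.single m' c')"
  for c c' :: "'a::comm_semiring_1"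
proof -
  let ?e = "Poly_Mapping.single v (1::nat)"
  have shift: "m + m' - ?e = (m - ?e) + m'" if "Poly_Mapping.lookup m v \<noteq> 0" for m m'
    using that by (intro poly_mapping_eqI) (auto simp: lookup_add lookup_minus lookup_single when_def)
  have *: "Poly_Mapping.single (m + m' - ?e) (of_nat (Poly_Mapping.lookup m v) * d)
      = Poly_Mapping.single ((m - ?e) + m') (of_nat (Poly_Mapping.lookup m v) * d)" for m m' and d :: 'a
    by (cases "Poly_Mapping.lookup m v = 0") (auto simp: shift[simplified])
  have "mderiv v (Poly_Mapping.single m c * Poly_Mapping.single m' c')
     = Poly_Mapping.single (m + m' - ?e) (of_nat (Poly_Mapping.lookup m v) * (c * c'))
     + Poly_Mapping.single (m' + m - ?e) (of_nat (Poly_Mapping.lookup m' v) * (c * c'))"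
    by (simp add: mult_single mderiv_single lookup_add ring_distribs single_add add.commute)
  then show ?thesis
    unfolding * by (simp add: mderiv_single mult_single ac_simps)
qed

lemma mderiv_mult: "mderiv v (p * q) = mderiv v p * q + p * mderiv v q"
  for p q :: "('v, 'a::comm_semiring_1) mpoly"
proof -
  define P where "P m = Poly_Mapping.single m (Poly_Mapping.lookup p m)" for m
  define Q where "Q m = Poly_Mapping.single m (Poly_Mapping.lookup q m)" for m
  have p: "p = sum P (Poly_Mapping.keys p)" and q: "q = sum Q (Poly_Mapping.keys q)"
    unfolding P_def Q_def by (rule mpoly_sum_monomials)+
  have "mderiv v (sum P S * sum Q T) = mderiv v (sum P S) * sum Q T + sum P S * mderiv v (sum Q T)" for S T
    unfolding sum_product mderiv_sum sum.distrib[symmetric] P_def Q_def mderiv_single_mult ..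
  from this[of "Poly_Mapping.keys p" "Poly_Mapping.keys q"] show ?thesis
    unfolding p[symmetric] q[symmetric] .
qed

lemma mderiv_uminus: "mderiv v (- p) = - mderiv v p" for p :: "('v, 'a::comm_ring_1) mpoly"
  using mderiv_add[of v p "- p"] by (simp add: eq_neg_iff_add_eq_0 add.commute)

lemma mderiv_diff: "mderiv v (p - q) = mderiv v p - mderiv v q" for p q :: "('v, 'a::comm_ring_1) mpoly"
  using mderiv_add[of v p "- q"] by (simp add: mderiv_uminus)

lemma indets_mderiv: "indets (mderiv v p) \<subseteq> indets p" for p :: "('v, 'a::comm_semiring_1) mpoly"
  unfolding mderiv_def
proof (rule indets_sum)
  fix m assume m: "m \<in> Poly_Mapping.keys p"
  have "Poly_Mapping.keys (m - Poly_Mapping.single v 1) \<subseteq> Poly_Mapping.keys m"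
    by (auto simp: in_keys_iff lookup_minus)
  with m show "indets (Poly_Mapping.single (m - Poly_Mapping.single v 1)
      (of_nat (Poly_Mapping.lookup m v) * Poly_Mapping.lookup p m)) \<subseteq> indets p"
    by (auto simp: indets_def split: if_splits)
qed

text \<open>Both sides are derivations of the polynomial ring along the substitution, and they agree on
  the indeterminates. The derivation is a parameter because two are needed later:
  differentiation in \<open>t\<close> and coefficientwise differentiation with respect to an unknown.\<close>

lemma (in comm_ring_hom) mpoly_subst_chain_rule:
  assumes add: "\<And>a b. D (a + b) = D a + D b"
    and mult: "\<And>a b. D (a * b) = D a * b + a * D b"
    and const: "\<And>c. D (hom c) = 0"
    and V: "finite V" "indets p \<subseteq> V"
  shows "D (mpoly_subst hom pt p) = (\<Sum>v\<in>V. D (pt v) * mpoly_subst hom pt (mderiv v p))"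
  using V(2)
proof (induction p rule: mpoly_induct)
  case (const c)
  then show ?case by (simp add: assms(3) mpoly_subst_0)
next
  case (var w)
  have "mpoly_subst hom pt 1 = 1"
    using mpoly_subst_mConst[of pt 1] by (simp add: mConst_def)
  then have "D (pt v) * mpoly_subst hom pt (mderiv v (mVar w)) = (if v = w then D (pt v) else 0)" for v
    by (simp add: mderiv_mVar mpoly_subst_0)
  then show ?case using var V(1) by simp
next
  case (add p q)
  then show ?case
    by (simp add: mpoly_subst_add mderiv_add assms(1) sum.distrib ring_distribs)
next
  case (mult p q)
  then show ?case
    by (simp add: mpoly_subst_add mpoly_subst_mult mderiv_mult assms(2) sum.distrib ring_distribs
        sum_distrib_left sum_distrib_right ac_simps)
qed

lemma (in comm_ring_hom) mpoly_subst_compose: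
  assumes "comm_ring_hom h"
  shows "h (mpoly_subst hom pt p) = mpoly_subst (\<lambda>c. h (hom c)) (\<lambda>v. h (pt v)) p"
proof -
  interpret h: comm_ring_hom h by fact
  interpret hh: comm_ring_hom "\<lambda>c. h (hom c)"
    by unfold_locales (simp_all add: hom_add hom_mult h.hom_add h.hom_mult)
  have "indets p \<subseteq> UNIV" by simp
  then show ?thesis
    by (induction p rule: mpoly_induct)
       (simp_all add: mpoly_subst_add hh.mpoly_subst_add mpoly_subst_mult hh.mpoly_subst_mult
         h.hom_add h.hom_mult)
qed

lemma mpoly_subst_cong:
  assumes "comm_ring_hom c" "indets p \<subseteq> V" "\<And>v. v \<in> V \<Longrightarrow> pt v = pt' v"
  shows "mpoly_subst c pt p = mpoly_subst c pt' p"
proof -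
  interpret comm_ring_hom c by fact
  show ?thesis using assms(2)
    by (induction p rule: mpoly_induct)
       (use assms(3) in \<open>simp_all add: mpoly_subst_add mpoly_subst_mult\<close>)
qed

lemma comm_ring_hom_id: "comm_ring_hom (\<lambda>c::'a::comm_ring_1. c)"
  by unfold_locales simp_all

lemma comm_ring_hom_meval: "comm_ring_hom (meval pt)" for pt :: "'v \<Rightarrow> 'a::comm_ring_1"
  unfolding meval_eq_mpoly_subst
  by (rule comm_ring_hom.comm_ring_hom_mpoly_subst[OF comm_ring_hom_id])

lemma meval_mVar: "meval pt (mVar v) = pt v" and meval_mConst: "meval pt (mConst c) = c"
  for pt :: "'v \<Rightarrow> 'a::comm_ring_1"
  by (simp_all add: meval_eq_mpoly_subst comm_ring_hom.mpoly_subst_mVar[OF comm_ring_hom_id]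
      comm_ring_hom.mpoly_subst_mConst[OF comm_ring_hom_id])

section \<open>Matrices of corank one\<close>

text \<open>The matrix without its first row and column. The entries are given by a function indexed
  like the full matrix, so that the same block serves for scalars and for polynomials.\<close>

definition lower_block :: "nat \<Rightarrow> (nat \<Rightarrow> nat \<Rightarrow> 'a) \<Rightarrow> 'a mat" where
  "lower_block n M = mat (n - 1) (n - 1) (\<lambda>(i, j). M (Suc i) (Suc j))"

lemma lower_block_carrier: "lower_block n M \<in> carrier_mat (n - 1) (n - 1)"
  by (simp add: lower_block_def)

lemma sum_drop_first: "(\<Sum>j\<in>{1..<n}. f j) = (\<Sum>j<n - 1. f (Suc j))"
  by (cases n) (simp_all only: One_nat_def sum.atLeast_Suc_lessThan_Suc_shift lessThan_atLeast0 comp_def diff_Suc_1, simp_all)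

lemma sum_drop_first_Suc: "(\<Sum>j = Suc 0..<n. f j) = (\<Sum>j = 0..<n - Suc 0. f (Suc j))"
  using sum_drop_first[of f n] by (simp add: lessThan_atLeast0)

lemma smult_one_mat_mult_vec:
  "v \<in> carrier_vec m \<Longrightarrow> (d \<cdot>\<^sub>m 1\<^sub>m m) *\<^sub>v v = d \<cdot>\<^sub>v v" for d :: "'a::comm_ring_1"
  by (intro eq_vecI) (simp_all add: scalar_prod_def mult.assoc if_distrib[of "\<lambda>x. x * _"]
      if_distrib[of "\<lambda>x. d * x"] cong: if_cong)

lemma lower_block_mult_vec:
  assumes "i < n - 1"
  shows "(lower_block n M *\<^sub>v vec (n - 1) (\<lambda>j. u (Suc j))) $ i = (\<Sum>j\<in>{1..<n}. M (Suc i) j * u j)"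
  using assms by (simp add: lower_block_def scalar_prod_def sum_drop_first_Suc)

text \<open>Cramer's rule over a commutative ring, written in the indices of the full matrix; this is
  what survives of invertibility when the entries are polynomials.\<close>

lemma lower_block_left_inverse:
  fixes M :: "nat \<Rightarrow> nat \<Rightarrow> 'a::comm_ring_1"
  assumes "j \<in> {1..<n}"
  shows "(\<Sum>i\<in>{1..<n}. adj_mat (lower_block n M) $$ (j - 1, i - 1) * (\<Sum>k\<in>{1..<n}. M i k * y k))
       = det (lower_block n M) * y j"
proof -
  let ?B = "lower_block n M" let ?y = "vec (n - 1) (\<lambda>j. y (Suc j))"
  note A = adj_mat[OF lower_block_carrier[of n M]]
  have "adj_mat ?B *\<^sub>v (?B *\<^sub>v ?y) = (det ?B \<cdot>\<^sub>m 1\<^sub>m (n - 1)) *\<^sub>v ?y"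
    using A lower_block_carrier by (metis assoc_mult_mat_vec vec_carrier)
  then have "(adj_mat ?B *\<^sub>v (?B *\<^sub>v ?y)) $ (j - 1) = ((det ?B \<cdot>\<^sub>m 1\<^sub>m (n - 1)) *\<^sub>v ?y) $ (j - 1)" by simp
  also have "((det ?B \<cdot>\<^sub>m 1\<^sub>m (n - 1)) *\<^sub>v ?y) = det ?B \<cdot>\<^sub>v ?y"
    by (simp add: smult_one_mat_mult_vec)
  finally have "(adj_mat ?B *\<^sub>v (?B *\<^sub>v ?y)) $ (j - 1) = det ?B * y j"
    using assms by (auto simp: less_diff_conv dest!: less_imp_Suc_add)
  moreover have "(adj_mat ?B *\<^sub>v (?B *\<^sub>v ?y)) $ (j - 1)
      = (\<Sum>i<n - 1. adj_mat ?B $$ (j - 1, i) * (?B *\<^sub>v ?y) $ i)"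
    using A(1) assms lower_block_carrier[of n M]
    by (cases j) (simp_all add: scalar_prod_def lessThan_atLeast0 less_diff_conv)
  moreover have "\<dots> = (\<Sum>i<n - 1. adj_mat ?B $$ (j - 1, i) * (\<Sum>k\<in>{1..<n}. M (Suc i) k * y k))"
    by (intro sum.cong refl) (simp only: lower_block_mult_vec lessThan_iff)
  moreover have "\<dots> = (\<Sum>i\<in>{1..<n}. adj_mat ?B $$ (j - 1, i - 1) * (\<Sum>k\<in>{1..<n}. M i k * y k))"
    by (subst sum_drop_first[where f = "\<lambda>i. adj_mat ?B $$ (j - 1, i - 1) * _ i"]) simp
  ultimately show ?thesis by metis
qed

lemma lower_block_kernel_trivial:
  fixes M :: "nat \<Rightarrow> nat \<Rightarrow> 'a::field"
  assumes "det (lower_block n M) \<noteq> 0" "j \<in> {1..<n}"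
    and "\<And>i. i \<in> {1..<n} \<Longrightarrow> (\<Sum>k\<in>{1..<n}. M i k * y k) = 0"
  shows "y j = 0"
  using lower_block_left_inverse[OF assms(2), of M y] assms(1,3) by simp

lemma lower_block_solvable:
  fixes M :: "nat \<Rightarrow> nat \<Rightarrow> 'a::field"
  assumes "det (lower_block n M) \<noteq> 0"
  obtains y where "\<And>i. i \<in> {1..<n} \<Longrightarrow> (\<Sum>k\<in>{1..<n}. M i k * y k) = r i"
proof -
  let ?B = "lower_block n M" let ?r = "vec (n - 1) (\<lambda>j. r (Suc j))"
  note A = adj_mat[OF lower_block_carrier[of n M]]
  define v where "v = adj_mat ?B *\<^sub>v ((1 / det ?B) \<cdot>\<^sub>v ?r)"
  define y where "y j = v $ (j - 1)" for j
  have "?B *\<^sub>v v = (det ?B \<cdot>\<^sub>m 1\<^sub>m (n - 1)) *\<^sub>v ((1 / det ?B) \<cdot>\<^sub>v ?r)"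
    unfolding v_def using A lower_block_carrier
    by (metis assoc_mult_mat_vec vec_carrier smult_carrier_vec)
  also have "\<dots> = ?r"
    using assms by (simp add: smult_one_mat_mult_vec smult_smult_assoc)
  finally have Bv: "?B *\<^sub>v v = ?r" .
  have v: "vec (n - 1) (\<lambda>j. y (Suc j)) = v"
    using A(1) by (intro eq_vecI) (auto simp: y_def v_def)
  have "(\<Sum>k\<in>{1..<n}. M i k * y k) = r i" if "i \<in> {1..<n}" for i
    using lower_block_mult_vec[of "i - 1" n M y] that Bv unfolding v by (cases i) auto
  then show thesis by (rule that)
qed

text \<open>The first column lies in the span of the other \<open>n - 1\<close>, which therefore have rank
  \<open>n - 1\<close> and are independent. A kernel vector of the block is then impossible: extended by
  a zero it is annihilated by the rows \<open>1, \<dots>, n - 1\<close>, hence by row \<open>0\<close>, and so it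
  is a relation between independent columns.\<close>

lemma corank1_lower_block:
  fixes J :: "'a::field mat"
  assumes n: "n \<ge> 1" and J: "J \<in> carrier_mat n n" and cr: "corank J = 1"
    and first_row: "\<exists>c. row J 0 = vec n (\<lambda>j. \<Sum>i \<in> {1..<n}. c i * J $$ (i, j))"
    and first_col: "\<exists>c. col J 0 = vec n (\<lambda>i. \<Sum>j \<in> {1..<n}. c j * J $$ (i, j))"
  shows "det (lower_block n (\<lambda>i j. J $$ (i, j))) \<noteq> 0"
proof
  interpret vec_space "TYPE('a)" n .
  let ?B = "lower_block n (\<lambda>i j. J $$ (i, j))"
  define C where "C = mat n (n - 1) (\<lambda>(i, j). J $$ (i, Suc j))"
  have C: "C \<in> carrier_mat n (n - 1)" by (simp add: C_def)
  have colC: "col C j = col J (Suc j)" if "j < n - 1" for j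
    using that J by (intro eq_vecI) (simp_all add: C_def)
  have cols: "set (cols J) = insert (col J 0) (set (cols C))"
  proof -
    have "set (cols J) = col J ` {..<n}" using J by (simp add: cols_def lessThan_atLeast0)
    also have "{..<n} = insert 0 (Suc ` {..<n - 1})"
      using n by (cases n) (simp_all add: lessThan_Suc_eq_insert_0)
    also have "col J ` \<dots> = insert (col J 0) (col C ` {..<n - 1})"
      using colC by (simp add: image_image)
    also have "col C ` {..<n - 1} = set (cols C)" using C by (simp add: cols_def lessThan_atLeast0)
    finally show ?thesis .
  qed
  obtain c where c: "col J 0 = vec n (\<lambda>i. \<Sum>j \<in> {1..<n}. c j * J $$ (i, j))" using first_col by blast
  have "C *\<^sub>v vec (n - 1) (\<lambda>j. c (Suc j)) = col J 0"
    unfolding c by (intro eq_vecI)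
      (simp_all add: C_def scalar_prod_def sum_drop_first_Suc mult.commute)
  then have "col J 0 \<in> col_space C"
    using C col_space_eq[OF C] J by (auto intro!: exI[of _ "vec (n - 1) (\<lambda>j. c (Suc j))"])
  then have in_span: "col J 0 \<in> span (set (cols C))" by (simp add: col_space_def)
  have colsC: "set (cols C) \<subseteq> carrier_vec n" using C cols_dim by blast
  have "span (set (cols C)) = span (set (cols C) \<union> {col J 0})"
    by (rule already_in_span) (use colsC in_span in auto)
  then have "rank C = rank J" unfolding rank_def cols by simp
  then have rC: "rank C = n - 1" using cr J by (simp add: corank_def)
  obtain S where S: "finite S" "maximal S (\<lambda>T. T \<subseteq> set (cols C) \<and> lin_indpt T)"
    using maximal_exists_superset[of "set (cols C)" "\<lambda>T. T \<subseteq> set (cols C) \<and> lin_indpt T" "{}"]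
    by (metis (no_types, lifting) List.finite_set empty_subsetI finite_lin_indpt2 finite.emptyI
        ex_in_conv)
  have "card S = n - 1" using rank_card_indpt[OF C S(2)] rC by simp
  moreover have "S \<subseteq> set (cols C)" "lin_indpt S" using S(2) by (auto simp: maximal_def)
  moreover have "card (set (cols C)) \<le> n - 1" using card_length[of "cols C"] C by simp
  ultimately have "S = set (cols C)" "card (set (cols C)) = length (cols C)"
    using C by (metis List.finite_set card_seteq, metis List.finite_set card_mono cols_length carrier_matD(2) le_antisym)
  then have "distinct (cols C)" "lin_indpt (set (cols C))"
    using \<open>lin_indpt S\<close> by (auto simp: card_distinct)
  note indep = this
  assume "det ?B = 0"
  then obtain v where v: "v \<in> carrier_vec (n - 1)" "v \<noteq> 0\<^sub>v (n - 1)" "?B *\<^sub>v v = 0\<^sub>v (n - 1)"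
    using det_0_iff_vec_prod_zero_field[OF lower_block_carrier] by blast
  obtain d where d: "row J 0 = vec n (\<lambda>j. \<Sum>i \<in> {1..<n}. d i * J $$ (i, j))" using first_row by blast
  have Cv: "(C *\<^sub>v v) $ Suc i = 0" if "i < n - 1" for i
  proof -
    have "(C *\<^sub>v v) $ Suc i = (?B *\<^sub>v v) $ i"
      using that v(1) by (simp add: C_def lower_block_def scalar_prod_def)
    then show ?thesis using v(3) that by simp
  qed
  have "(C *\<^sub>v v) $ 0 = (\<Sum>j<n - 1. J $$ (0, Suc j) * v $ j)"
    using n v(1) by (simp add: C_def scalar_prod_def lessThan_atLeast0)
  also have "\<dots> = (\<Sum>j<n - 1. \<Sum>i \<in> {1..<n}. d i * (J $$ (i, Suc j) * v $ j))"
  proof (intro sum.cong refl)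
    fix j assume "j \<in> {..<n - 1}"
    then have "row J 0 $ Suc j = (\<Sum>i \<in> {1..<n}. d i * J $$ (i, Suc j))" unfolding d by simp
    then show "J $$ (0, Suc j) * v $ j = (\<Sum>i \<in> {1..<n}. d i * (J $$ (i, Suc j) * v $ j))"
      using J n \<open>j \<in> _\<close> by (simp add: sum_distrib_right mult.assoc)
  qed
  also have "\<dots> = (\<Sum>i \<in> {1..<n}. d i * (C *\<^sub>v v) $ i)"
    using v(1) by (subst sum.swap)
      (simp add: C_def scalar_prod_def lessThan_atLeast0 sum_distrib_left)
  also have "\<dots> = 0" using Cv by (intro sum.neutral) (auto simp: Suc_le_eq less_diff_conv gr0_conv_Suc)
  finally have "(C *\<^sub>v v) $ 0 = 0" .
  then have "C *\<^sub>v v = 0\<^sub>v n"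
  proof (intro eq_vecI)
    fix i assume "i < dim_vec (0\<^sub>v n)"
    then show "(C *\<^sub>v v) $ i = 0\<^sub>v n $ i"
      using Cv[of "i - 1"] \<open>(C *\<^sub>v v) $ 0 = 0\<close> by (cases i) auto
  qed (use C in simp)
  with lin_depI[OF C v(1,2)] indep show False by blast
qed

lemma lower_block_imp_full_rank:
  fixes J :: "'a::field mat"
  assumes n: "n \<ge> 1" and J: "J \<in> carrier_mat n n"
    and det: "det (lower_block n (\<lambda>i j. J $$ (i, j))) \<noteq> 0"
  shows "vec_space.rank n (mat_of_cols n (map (col J) [1..<n] @ [unit_vec n 0])) = n"
proof -
  interpret vec_space "TYPE('a)" n .
  let ?E = "mat_of_cols n (map (col J) [1..<n] @ [unit_vec n 0])"
  have E: "?E \<in> carrier_mat n n" using n by (simp add: mat_of_cols_def)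
  have entry: "?E $$ (i, j) = (if j < n - 1 then J $$ (i, Suc j) else unit_vec n 0 $ i)"
    if "i < n" "j < n" for i j
    using that J n by (auto simp: mat_of_cols_index nth_append)
  have "det ?E \<noteq> 0"
  proof
    assume "det ?E = 0"
    then obtain v where v: "v \<in> carrier_vec n" "v \<noteq> 0\<^sub>v n" "?E *\<^sub>v v = 0\<^sub>v n"
      using det_0_iff_vec_prod_zero_field[OF E] by blast
    have row: "(\<Sum>j=1..<n. J $$ (i, j) * v $ (j - 1)) + unit_vec n 0 $ i * v $ (n - 1) = 0" if "i < n" for i
    proof -
      have "0 = (?E *\<^sub>v v) $ i" using v(3) that by simp
      also have "\<dots> = (\<Sum>j<n. ?E $$ (i, j) * v $ j)"
        using that v(1) E by (simp add: scalar_prod_def lessThan_atLeast0)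
      also have "{..<n} = insert (n - 1) {..<n - 1}" using n by auto
      also have "(\<Sum>j\<in>insert (n - 1) {..<n - 1}. ?E $$ (i, j) * v $ j) =
          (\<Sum>j<n - 1. J $$ (i, Suc j) * v $ j) + unit_vec n 0 $ i * v $ (n - 1)"
        using that n entry by (subst sum.insert) (auto simp: add.commute)
      finally show ?thesis by (simp add: sum_drop_first_Suc lessThan_atLeast0)
    qed
    have v0: "v $ (j - 1) = 0" if "j \<in> {1..<n}" for j
    proof (rule lower_block_kernel_trivial[OF det that, of "\<lambda>j. v $ (j - 1)"])
      fix i assume "i \<in> {1..<n}"
      then show "(\<Sum>k\<in>{1..<n}. J $$ (i, k) * v $ (k - 1)) = 0" using row[of i] by simp
    qed
    then have "v $ (n - 1) = 0" using row[of 0] n by simp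
    have "v = 0\<^sub>v n"
    proof (intro eq_vecI)
      fix i assume "i < dim_vec (0\<^sub>v n)"
      then show "v $ i = 0\<^sub>v n $ i"
        using v0[of "Suc i"] \<open>v $ (n - 1) = 0\<close> by (cases "i = n - 1") auto
    qed (use v(1) in simp)
    with v(2) show False by simp
  qed
  then show ?thesis using det_rank_iff[OF E] by simp
qed

lemma invertible_mat_if_trivial_kernel:
  fixes T :: "'a::field mat"
  assumes T: "T \<in> carrier_mat m m"
    and ker: "\<And>v. v \<in> carrier_vec m \<Longrightarrow> T *\<^sub>v v = 0\<^sub>v m \<Longrightarrow> v = 0\<^sub>v m"
  shows "invertible_mat T"
proof -
  have "det T \<noteq> 0" using ker det_0_iff_vec_prod_zero_field[OF T] by blast
  then have "T \<in> Units (ring_mat TYPE('a) m ())" by (rule det_non_zero_imp_unit[OF T])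
  then obtain U where "U \<in> carrier_mat m m" "U * T = 1\<^sub>m m" "T * U = 1\<^sub>m m"
    by (auto simp: Units_def ring_mat_def)
  with T show ?thesis unfolding invertible_mat_def inverts_mat_def by fastforce
qed

section \<open>The operators $L_k$ as coefficients along a generic arc\<close>

lemma finite_indets: "finite (indets p)"
  by (simp add: indets_def)

definition fps_map :: "('a \<Rightarrow> 'b) \<Rightarrow> 'a fps \<Rightarrow> 'b fps" where
  "fps_map h f = Abs_fps (\<lambda>k. h (fps_nth f k))"

lemma fps_map_nth [simp]: "fps_nth (fps_map h f) k = h (fps_nth f k)"
  by (simp add: fps_map_def)

lemma comm_ring_hom_fps_map: "comm_ring_hom h \<Longrightarrow> comm_ring_hom (fps_map h)"
proof -
  assume "comm_ring_hom h"
  then interpret comm_ring_hom h .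
  show ?thesis
    by unfold_locales (simp_all add: fps_eq_iff hom_add hom_mult fps_mult_nth hom_sum)
qed

lemma comm_ring_hom_fps_const: "comm_ring_hom fps_const"
  by unfold_locales simp_all

lemma comm_ring_hom_mConst: "comm_ring_hom mConst"
  by unfold_locales (simp_all add: mConst_def single_add mult_single)

lemma comm_ring_hom_comp: "comm_ring_hom f \<Longrightarrow> comm_ring_hom g \<Longrightarrow> comm_ring_hom (\<lambda>x. f (g x))"
proof -
  assume "comm_ring_hom f" "comm_ring_hom g"
  then interpret f: comm_ring_hom f + g: comm_ring_hom g .
  show ?thesis by unfold_locales (simp_all add: f.hom_add g.hom_add f.hom_mult g.hom_mult)
qed

lemma comm_ring_hom_fps_const_mConst: "comm_ring_hom (\<lambda>c. fps_const (mConst c))"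
  by (rule comm_ring_hom_comp[OF comm_ring_hom_fps_const comm_ring_hom_mConst])

text \<open>The arc whose coefficients are the unknowns themselves. The variables \<open>B\<close> and \<open>A\<close>,
  and coordinates beyond the first \<open>n\<close>, stay constant, because the operators differentiate
  only with respect to the first \<open>n\<close> coordinates.\<close>

fun generic_arc :: "nat \<Rightarrow> pvar \<Rightarrow> 'a::comm_ring_1 pvpoly fps" where
  "generic_arc n (X j) =
     Abs_fps (\<lambda>k. if k = 0 then mVar (X j) else if j < n then avec n (Suc k) $ j else 0)"
| "generic_arc n (B \<nu>) = fps_const (mVar (B \<nu>))"
| "generic_arc n (A k j) = fps_const (mVar (A k j))"

definition along_arc :: "nat \<Rightarrow> 'a::comm_ring_1 pvpoly \<Rightarrow> 'a pvpoly fps" where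
  "along_arc n = mpoly_subst (\<lambda>c. fps_const (mConst c)) (generic_arc n)"

lemma fps_deriv_along_arc:
  "fps_deriv (along_arc n p) = (\<Sum>j<n. fps_deriv (generic_arc n (X j)) * along_arc n (mderiv (X j) p))"
proof -
  interpret comm_ring_hom "\<lambda>c::'a. fps_const (mConst c :: 'a pvpoly)"
    by (rule comm_ring_hom_fps_const_mConst)
  let ?V = "indets p \<union> X ` {..<n}"
  have zero: "fps_deriv (generic_arc n v :: 'a pvpoly fps) = 0" if "v \<notin> X ` {..<n}" for v
    using that by (cases v) (auto simp: fps_eq_iff)
  have "fps_deriv (along_arc n p) = (\<Sum>v\<in>?V. fps_deriv (generic_arc n v) * along_arc n (mderiv v p))"
    unfolding along_arc_def by (rule mpoly_subst_chain_rule) (auto simp: finite_indets)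
  also have "\<dots> = (\<Sum>v\<in>X ` {..<n}. fps_deriv (generic_arc n v) * along_arc n (mderiv v p))"
    by (rule sum.mono_neutral_right) (auto simp: finite_indets zero)
  finally show ?thesis by (simp add: sum.reindex inj_on_def)
qed

text \<open>Partial derivatives of the coefficients along the arc with respect to any unknown, including
  the coefficients of the arc itself; this describes the columns of the Jacobian of the deflated
  system.\<close>

lemma fps_map_mderiv_along_arc:
  assumes "finite V" "indets p \<subseteq> V"
  shows "fps_map (mderiv u) (along_arc n p)
       = (\<Sum>v\<in>V. fps_map (mderiv u) (generic_arc n v) * along_arc n (mderiv v p))"
proof -
  interpret comm_ring_hom "\<lambda>c::'a. fps_const (mConst c :: 'a pvpoly)"
    by (rule comm_ring_hom_fps_const_mConst)
  have "fps_map (mderiv u) (f * g) = fps_map (mderiv u) f * g + f * fps_map (mderiv u) g"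
    for f g :: "'a pvpoly fps"
    by (simp add: fps_eq_iff fps_mult_nth mderiv_sum mderiv_mult sum.distrib)
  then show ?thesis
    unfolding along_arc_def
    by (intro mpoly_subst_chain_rule) (simp_all add: assms fps_eq_iff mderiv_add)
qed

text \<open>Translating the constant term of the arc commutes with expanding along it. In the recursion
  for \<open>Lop\<close>, it allows the Jacobian of an earlier vector to be computed before expanding.\<close>

lemma mderiv_X_along_arc:
  assumes "m < n"
  shows "mderiv (X m) (fps_nth (along_arc n p) k) = fps_nth (along_arc n (mderiv (X m) p)) k"
proof -
  have avec0: "mderiv (X m) (avec n i $ j :: 'a pvpoly) = 0" if "j < n" for i j
    using that by (simp add: avec_def mderiv_mVar)
  have arc: "fps_map (mderiv (X m)) (generic_arc n v :: 'a pvpoly fps) = (if v = X m then 1 else 0)" for v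
    by (cases v) (auto simp: fps_eq_iff mderiv_mVar avec0)
  have "fps_map (mderiv (X m)) (along_arc n p)
      = (\<Sum>v\<in>insert (X m) (indets p). fps_map (mderiv (X m)) (generic_arc n v) * along_arc n (mderiv v p))"
    by (rule fps_map_mderiv_along_arc) (auto simp: finite_indets)
  also have "\<dots> = (\<Sum>v\<in>insert (X m) (indets p). if v = X m then along_arc n (mderiv (X m) p) else 0)"
    by (intro sum.cong) (auto simp: arc)
  also have "\<dots> = along_arc n (mderiv (X m) p)"
    by (simp add: finite_indets)
  finally show ?thesis by (metis fps_map_nth)
qed

lemma jacobian_mult_avec:
  "i < n \<Longrightarrow> (jacobian n H *\<^sub>v avec n k) $ i = (\<Sum>j<n. mderiv (X j) (H $ i) * avec n k $ j)"
  by (simp add: jacobian_def scalar_prod_def avec_def lessThan_atLeast0)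

text \<open>The derivative of \<open>p(x(t))\<close> in \<open>t\<close>, expanded by the chain rule: this is the
  recursion defining the operators $L_k$ before division by \<open>k - 1\<close>.\<close>

lemma along_arc_recursion:
  fixes p :: "'a::comm_ring_1 pvpoly"
  shows "of_nat (Suc k) * fps_nth (along_arc n p) (Suc k)
     = (\<Sum>i\<le>k. of_nat (Suc i) * (\<Sum>j<n. avec n (i + 2) $ j * fps_nth (along_arc n (mderiv (X j) p)) (k - i)))"
proof -
  have "of_nat (Suc k) * fps_nth (along_arc n p) (Suc k) = fps_nth (fps_deriv (along_arc n p)) k"
    by (simp add: add.commute)
  also have "\<dots> = (\<Sum>j<n. \<Sum>i\<le>k. of_nat (Suc i) * (avec n (i + 2) $ j * fps_nth (along_arc n (mderiv (X j) p)) (k - i)))"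
    unfolding fps_deriv_along_arc
    by (simp add: fps_sum_nth fps_mult_nth atLeast0AtMost add.commute mult.assoc)
  also have "\<dots> = (\<Sum>i\<le>k. of_nat (Suc i) * (\<Sum>j<n. avec n (i + 2) $ j * fps_nth (along_arc n (mderiv (X j) p)) (k - i)))"
    by (subst sum.swap) (simp add: sum_distrib_left)
  finally show ?thesis .
qed

lemma along_arc_0: "fps_nth (along_arc n p) 0 = p"
proof -
  interpret comm_ring_hom "\<lambda>c::'a. fps_const (mConst c :: 'a pvpoly)"
    by (rule comm_ring_hom_fps_const_mConst)
  have "indets p \<subseteq> UNIV" by simp
  then show ?thesis
  proof (induction p rule: mpoly_induct)
    case (var v)
    then show ?case by (cases v) (simp_all add: along_arc_def)
  qed (simp_all add: along_arc_def mpoly_subst_add mpoly_subst_mult)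
qed

text \<open>Both sides satisfy the same recursion. Its top term, in which the Jacobian of the system
  itself meets $a_k$, is the summand that \<open>Lop\<close> splits off.\<close>

theorem Lop_eq_along_arc:
  fixes H :: "'a::field_char_0 pvpoly vec"
  assumes "k \<ge> 2" "i < n"
  shows "Lop n H k $ i = fps_nth (along_arc n (H $ i)) (k - 1)"
  using assms(1)
proof (induction k rule: less_induct)
  case (less k)
  let ?h = "\<lambda>j. along_arc n (mderiv (X j) (H $ i))"
  define T where "T l = (\<Sum>j<n. avec n (l + 2) $ j * fps_nth (?h j) (k - 2 - l))" for l
  have top: "(jacobian n H *\<^sub>v avec n k) $ i = T (k - 2)"
    using assms(2) less.prems
    by (simp add: jacobian_mult_avec T_def along_arc_0 mult.commute numeral_2_eq_2 Suc_diff_Suc)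
  have inner: "(jacobian n (Lop n H (k - j)) *\<^sub>v avec n (j + 1)) $ i = T (j - 1)" if "j \<in> {1..k - 2}" for j
  proof -
    have "mderiv (X m) (Lop n H (k - j) $ i) = fps_nth (?h m) (k - 2 - (j - 1))" if "m < n" for m
    proof -
      have "Lop n H (k - j) $ i = fps_nth (along_arc n (H $ i)) (k - j - 1)"
        using \<open>j \<in> _\<close> by (intro less.IH) auto
      moreover have "k - j - 1 = k - 2 - (j - 1)" using \<open>j \<in> _\<close> by auto
      ultimately show ?thesis using mderiv_X_along_arc[OF that] by metis
    qed
    moreover have "j - 1 + 2 = j + 1" using that by auto
    ultimately show ?thesis
      using assms(2) by (simp add: jacobian_mult_avec T_def mult.commute)
  qed
  have scale: "mConst (of_nat m / of_nat (k - 1)) * (of_nat (k - 1) :: 'a pvpoly) = of_nat m" for m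
  proof -
    have "(of_nat (k - 1) :: 'a) \<noteq> 0" using less.prems by simp
    then have "of_nat m / of_nat (k - 1) * of_nat (k - 1) = (of_nat m :: 'a)"
      by (metis nonzero_eq_divide_eq)
    then show ?thesis
      unfolding mConst_def of_nat_single comp_def mult_single by (simp only: add_0)
  qed
  \<comment> \<open>The integer factor is a unit: its inverse is a constant polynomial.\<close>
  have unscale: "(p::'a pvpoly) = q" if "of_nat (k - 1) * p = of_nat (k - 1) * q" for p q
  proof -
    have "mConst (1 / of_nat (k - 1)) * (of_nat (k - 1) * p) = mConst (1 / of_nat (k - 1)) * (of_nat (k - 1) * q)"
      using that by simp
    then show ?thesis using scale[of 1] by (simp add: mult.assoc[symmetric])
  qed
  show ?case
  proof (rule unscale)
    have k2: "Suc (k - 2) = k - 1" using less.prems by simp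
    have "of_nat (k - 1) * fps_nth (along_arc n (H $ i)) (k - 1) = (\<Sum>l\<le>k - 2. of_nat (Suc l) * T l)"
      using along_arc_recursion[of "k - 2" n "H $ i"] unfolding k2 T_def .
    also have "\<dots> = (\<Sum>j\<in>{1..k - 1}. of_nat j * T (j - 1))"
      by (rule sum.reindex_bij_witness[of _ "\<lambda>j. j - 1" Suc]) (use less.prems in auto)
    finally have rhs: "of_nat (k - 1) * fps_nth (along_arc n (H $ i)) (k - 1)
        = (\<Sum>j\<in>{1..k - 1}. of_nat j * T (j - 1))" .
    show "of_nat (k - 1) * (Lop n H k $ i) = of_nat (k - 1) * fps_nth (along_arc n (H $ i)) (k - 1)"
    proof (cases "k = 2")
      case True
      then show ?thesis using rhs top by (subst Lop.simps) simp
    next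
      case False
      have "Lop n H k $ i = (\<Sum>j\<in>{1..k - 2}. mConst (of_nat j / of_nat (k - 1)) * T (j - 1)) + T (k - 2)"
      proof -
        have dim: "dim_row (jacobian n H' :: 'a pvpoly mat) = n" for H'
          by (simp add: jacobian_def)
        have "Lop n H k $ i = (\<Sum>j\<in>{1..k - 2}. mConst (of_nat j / of_nat (k - 1)) *
            (jacobian n (Lop n H (k - j)) *\<^sub>v avec n (j + 1)) $ i) + (jacobian n H *\<^sub>v avec n k) $ i"
          using False less.prems assms(2)
          by (subst Lop.simps) (simp add: dim del: index_mult_mat_vec)
        then show ?thesis unfolding top using inner by (simp only: cong: sum.cong)
      qed
      then have "of_nat (k - 1) * (Lop n H k $ i)
          = (\<Sum>j\<in>{1..k - 2}. of_nat j * T (j - 1)) + of_nat (k - 1) * T (k - 2)"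
        by (simp only: distrib_left sum_distrib_left mult.assoc[symmetric] mult.commute[of "of_nat (k - 1)" "mConst _"] scale)
      also have "\<dots> = (\<Sum>j\<in>{1..k - 1}. of_nat j * T (j - 1))"
        using less.prems by (subst (2) k2[symmetric]) (simp add: k2 numeral_2_eq_2)
      finally show ?thesis using rhs by simp
    qed
  qed
qed

section \<open>Arcs solving all equations but the first\<close>

text \<open>First order Taylor expansion in the direction \<open>r\<close>. It will be used with \<open>e\<close> a power of
  \<open>t\<close>, so that the remainder has at least twice the order of the perturbation.\<close>

lemma (in comm_ring_hom) mpoly_subst_taylor:
  assumes V: "finite V" "indets p \<subseteq> V"
  shows "\<exists>s. mpoly_subst hom (\<lambda>v. pt v + e * r v) p
      = mpoly_subst hom pt p + e * ((\<Sum>v\<in>V. r v * mpoly_subst hom pt (mderiv v p)) + e * s)"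
  using V(2)
proof (induction p rule: mpoly_induct)
  case (const c)
  then show ?case by (intro exI[of _ 0]) (simp add: mpoly_subst_0)
next
  case (var w)
  have "mpoly_subst hom pt 1 = 1"
    using mpoly_subst_mConst[of pt 1] by (simp add: mConst_def)
  then have "r v * mpoly_subst hom pt (mderiv v (mVar w)) = (if v = w then r v else 0)" for v
    by (simp add: mderiv_mVar mpoly_subst_0)
  then show ?case using var V(1) by (intro exI[of _ 0]) simp
next
  case (add p q)
  then obtain s t where
    "mpoly_subst hom (\<lambda>v. pt v + e * r v) p
      = mpoly_subst hom pt p + e * ((\<Sum>v\<in>V. r v * mpoly_subst hom pt (mderiv v p)) + e * s)"
    "mpoly_subst hom (\<lambda>v. pt v + e * r v) q
      = mpoly_subst hom pt q + e * ((\<Sum>v\<in>V. r v * mpoly_subst hom pt (mderiv v q)) + e * t)" by blast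
  then show ?case
    by (intro exI[of _ "s + t"])
       (simp add: mpoly_subst_add mderiv_add sum.distrib ring_distribs)
next
  case (mult p q)
  define P Q where "P = mpoly_subst hom pt p" and "Q = mpoly_subst hom pt q"
  define P' Q' where "P' = (\<Sum>v\<in>V. r v * mpoly_subst hom pt (mderiv v p))"
    and "Q' = (\<Sum>v\<in>V. r v * mpoly_subst hom pt (mderiv v q))"
  obtain s t where
    "mpoly_subst hom (\<lambda>v. pt v + e * r v) p = P + e * (P' + e * s)"
    "mpoly_subst hom (\<lambda>v. pt v + e * r v) q = Q + e * (Q' + e * t)"
    using mult.IH unfolding P_def Q_def P'_def Q'_def by blast
  moreover have "(\<Sum>v\<in>V. r v * mpoly_subst hom pt (mderiv v (p * q))) = P' * Q + P * Q'"
    unfolding P_def Q_def P'_def Q'_def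
    by (simp add: mpoly_subst_add mpoly_subst_mult mderiv_mult sum.distrib ring_distribs
        sum_distrib_left sum_distrib_right ac_simps)
  moreover have "mpoly_subst hom pt (p * q) = P * Q"
    unfolding P_def Q_def by (rule mpoly_subst_mult)
  ultimately show ?case
    by (intro exI[of _ "P * t + s * Q + P' * Q' + e * (P' * t + s * Q') + e * e * s * t"])
       (simp add: mpoly_subst_mult algebra_simps)
qed

text \<open>Only polynomials in the coordinates \<open>X\<close> will be restricted to arcs; zero is a default value
  for the other variables.\<close>

fun coords :: "(nat \<Rightarrow> 'b::zero) \<Rightarrow> pvar \<Rightarrow> 'b" where
  "coords \<xi> (X j) = \<xi> j"
| "coords \<xi> (B \<nu>) = 0"
| "coords \<xi> (A k j) = 0"

text \<open>Restriction of a polynomial in the coordinates to the arc \<open>\<xi>\<close>, as a power series.\<close>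

definition pull :: "(nat \<Rightarrow> 'a fps) \<Rightarrow> 'a::comm_ring_1 pvpoly \<Rightarrow> 'a fps" where
  "pull \<xi> = mpoly_subst fps_const (coords \<xi>)"

lemma comm_ring_hom_pull: "comm_ring_hom (pull \<xi>)"
  unfolding pull_def by (rule comm_ring_hom.comm_ring_hom_mpoly_subst[OF comm_ring_hom_fps_const])

lemma coords_comp: "h 0 = 0 \<Longrightarrow> (\<lambda>v. h (coords \<xi> v)) = coords (\<lambda>j. h (\<xi> j))"
proof
  fix v assume "h 0 = 0"
  then show "h (coords \<xi> v) = coords (\<lambda>j. h (\<xi> j)) v" by (cases v) simp_all
qed

lemma comm_ring_hom_fps_nth_0: "comm_ring_hom (\<lambda>f. fps_nth f 0)"
  by unfold_locales simp_all

lemma pull_nth_0: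
  assumes p: "indets p \<subseteq> X ` {..<n}" and x: "\<And>j. j < n \<Longrightarrow> fps_nth (\<xi> j) 0 = x $ j"
  shows "fps_nth (pull \<xi> p) 0 = meval (xpoint x) p"
proof -
  have "fps_nth (pull \<xi> p) 0 = mpoly_subst (\<lambda>c. c) (coords (\<lambda>j. fps_nth (\<xi> j) 0)) p"
    unfolding pull_def
    using comm_ring_hom.mpoly_subst_compose[OF comm_ring_hom_fps_const comm_ring_hom_fps_nth_0,
        of "coords \<xi>" p] by (simp add: coords_comp[of "\<lambda>f. fps_nth f 0"])
  also have "\<dots> = mpoly_subst (\<lambda>c. c) (xpoint x) p"
    by (rule mpoly_subst_cong[OF _ p]) (auto simp: x comm_ring_hom_id)
  finally show ?thesis by (simp add: meval_eq_mpoly_subst)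
qed

lemma sum_X_image: "(\<Sum>v\<in>X ` {..<n}. f v) = (\<Sum>j<n. f (X j))"
  by (simp add: sum.reindex inj_on_def)

text \<open>Changing an arc from order \<open>k\<close> on changes a polynomial along it from order \<open>k\<close> on,
  and to first order by its differential at the base point.\<close>

lemma pull_perturb:
  assumes p: "indets p \<subseteq> X ` {..<n}"
    and agree: "\<And>j. j < n \<Longrightarrow> \<zeta> j = \<xi> j + fps_X ^ k * r j" and k: "k \<ge> 1"
    and x: "\<And>j. j < n \<Longrightarrow> fps_nth (\<xi> j) 0 = x $ j"
  obtains s where "pull \<zeta> p = pull \<xi> p + fps_X ^ k * s"
    "fps_nth s 0 = (\<Sum>j<n. fps_nth (r j) 0 * meval (xpoint x) (mderiv (X j) p))"
proof -
  interpret comm_ring_hom "fps_const :: 'a \<Rightarrow> _" by (rule comm_ring_hom_fps_const)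
  have "pull \<zeta> p = mpoly_subst fps_const (\<lambda>v. coords \<xi> v + fps_X ^ k * coords r v) p"
    unfolding pull_def by (rule mpoly_subst_cong[OF comm_ring_hom_fps_const p]) (auto simp: agree)
  then obtain s where s: "pull \<zeta> p
      = pull \<xi> p + fps_X ^ k * ((\<Sum>j<n. r j * pull \<xi> (mderiv (X j) p)) + fps_X ^ k * s)"
    using mpoly_subst_taylor[OF _ p, of "coords \<xi>" "fps_X ^ k" "coords r"] unfolding pull_def sum_X_image
    by auto
  have "fps_nth (pull \<xi> (mderiv (X j) p)) 0 = meval (xpoint x) (mderiv (X j) p)" for j
    using indets_mderiv[of "X j" p] p by (intro pull_nth_0 x) auto
  then show thesis
    using k by (intro that[OF s]) (simp add: fps_sum_nth)
qed

lemma fps_eq_upto_iff: "(\<forall>i<k. fps_nth f i = fps_nth g i) \<longleftrightarrow> (\<exists>r. f = g + fps_X ^ k * (r :: 'a::comm_ring_1 fps))"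
proof
  assume *: "\<forall>i<k. fps_nth f i = fps_nth g i"
  have "f = g + fps_X ^ k * fps_shift k (f - g)"
    using * by (auto simp: fps_eq_iff fps_X_power_mult_nth)
  then show "\<exists>r. f = g + fps_X ^ k * r" by blast
qed (auto simp: fps_X_power_mult_nth)

lemma pull_cong_upto:
  fixes p :: "'a::comm_ring_1 pvpoly"
  assumes p: "indets p \<subseteq> X ` {..<n}"
    and agree: "\<And>j i. j < n \<Longrightarrow> i < k \<Longrightarrow> fps_nth (\<zeta> j) i = fps_nth (\<xi> j) i"
    and i: "i < k"
  shows "fps_nth (pull \<zeta> p) i = fps_nth (pull \<xi> p) i"
proof -
  have "\<exists>r. \<zeta> j = \<xi> j + fps_X ^ k * r" if "j < n" for j
    using agree that fps_eq_upto_iff[of k "\<zeta> j" "\<xi> j"] by blast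
  then obtain r where "\<And>j. j < n \<Longrightarrow> \<zeta> j = \<xi> j + fps_X ^ k * r j" by metis
  then obtain s where "pull \<zeta> p = pull \<xi> p + fps_X ^ k * s"
    using pull_perturb[OF p, of \<zeta> \<xi> k r "vec n (\<lambda>j. fps_nth (\<xi> j) 0)"] i by auto
  with i show ?thesis by (simp add: fps_X_power_mult_nth)
qed

definition lin_block :: "nat \<Rightarrow> 'a::comm_ring_1 pvpoly vec \<Rightarrow> 'a vec \<Rightarrow> 'a mat" where
  "lin_block n F x = lower_block n (\<lambda>i j. meval (xpoint x) (mderiv (X j) (F $ i)))"

text \<open>At the first order where two arcs differ, the difference of their coefficients lies in the
  kernel of the block, by \<open>pull_perturb\<close>; the first coordinates agree by hypothesis.\<close>

lemma pull_lower_unique: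
  fixes F :: "'a::field pvpoly vec"
  assumes F: "\<And>i. i < n \<Longrightarrow> indets (F $ i) \<subseteq> X ` {..<n}"
    and det: "det (lin_block n F x) \<noteq> 0"
    and x: "\<And>j. j < n \<Longrightarrow> fps_nth (\<xi> j) 0 = x $ j" "\<And>j. j < n \<Longrightarrow> fps_nth (\<zeta> j) 0 = x $ j"
    and first: "\<xi> 0 = \<zeta> 0"
    and eq: "\<And>i k. i \<in> {1..<n} \<Longrightarrow> k < N \<Longrightarrow> fps_nth (pull \<xi> (F $ i)) k = fps_nth (pull \<zeta> (F $ i)) k"
    and "j < n" "k < N"
  shows "fps_nth (\<xi> j) k = fps_nth (\<zeta> j) k"
  using \<open>k < N\<close> \<open>j < n\<close>
proof (induction k arbitrary: j rule: less_induct)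
  case (less k)
  show ?case
  proof (cases "k = 0 \<or> j = 0")
    case True
    then show ?thesis using x less.prems first by auto
  next
    case False
    have "\<exists>r. \<zeta> j = \<xi> j + fps_X ^ k * r" if "j < n" for j
      using less that fps_eq_upto_iff[of k "\<zeta> j" "\<xi> j"] by (metis order.strict_trans)
    then obtain r where r: "\<And>j. j < n \<Longrightarrow> \<zeta> j = \<xi> j + fps_X ^ k * r j" by metis
    have r0: "fps_nth (\<zeta> j) k = fps_nth (\<xi> j) k + fps_nth (r j) 0" if "j < n" for j
      using r[OF that] by (simp add: fps_X_power_mult_nth)
    have "fps_nth (r j) 0 = 0"
    proof (rule lower_block_kernel_trivial[OF det[unfolded lin_block_def], of j "\<lambda>j. fps_nth (r j) 0"])
      show "j \<in> {1..<n}" using False less.prems by simp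
      fix i assume i: "i \<in> {1..<n}"
      have Fi: "indets (F $ i) \<subseteq> X ` {..<n}" using F i by simp
      have k1: "1 \<le> k" using False by simp
      obtain s where s: "pull \<zeta> (F $ i) = pull \<xi> (F $ i) + fps_X ^ k * s"
        "fps_nth s 0 = (\<Sum>j<n. fps_nth (r j) 0 * meval (xpoint x) (mderiv (X j) (F $ i)))"
        using pull_perturb[OF Fi r k1 x(1)] by blast
      have "fps_nth (r 0) 0 = 0" using r0[of 0] first less.prems by simp
      moreover have "fps_nth s 0 = 0"
        using eq[OF i less.prems(1)] unfolding s(1) by (simp add: fps_X_power_mult_nth)
      moreover have "{..<n} = insert 0 {1..<n}" using less.prems by auto
      ultimately show "(\<Sum>j\<in>{1..<n}. meval (xpoint x) (mderiv (X j) (F $ i)) * fps_nth (r j) 0) = 0"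
        using s(2) by (simp add: mult.commute)
    qed
    then show ?thesis using r0 less.prems by simp
  qed
qed

text \<open>Polynomial arcs are needed besides power series, because a polynomial in \<open>t\<close> can be
  evaluated at a coordinate function.\<close>

definition pull_poly :: "(nat \<Rightarrow> 'a poly) \<Rightarrow> 'a::comm_ring_1 pvpoly \<Rightarrow> 'a poly" where
  "pull_poly \<xi> = mpoly_subst (\<lambda>c. [:c:]) (coords \<xi>)"

lemma comm_ring_hom_const_poly: "comm_ring_hom (\<lambda>c. [:c:])"
  by unfold_locales simp_all

lemma comm_ring_hom_pull_poly: "comm_ring_hom (pull_poly \<xi>)"
  unfolding pull_poly_def by (rule comm_ring_hom.comm_ring_hom_mpoly_subst[OF comm_ring_hom_const_poly])

lemma comm_ring_hom_fps_of_poly: "comm_ring_hom fps_of_poly"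
  by unfold_locales (simp_all add: fps_of_poly_add fps_of_poly_mult)

lemma pull_fps_of_poly: "pull (\<lambda>j. fps_of_poly (\<xi> j)) p = fps_of_poly (pull_poly \<xi> p)"
  unfolding pull_poly_def pull_def
  using comm_ring_hom.mpoly_subst_compose[OF comm_ring_hom_const_poly comm_ring_hom_fps_of_poly,
      of "coords \<xi>" p]
  by (simp add: coords_comp[of fps_of_poly] fps_of_poly_const)

text \<open>Newton's method one order at a time: the correction in degree \<open>N\<close> is found by solving a
  linear system with the invertible block. Solutions modulo a power of \<open>t\<close> suffice, and keep
  the arc polynomial.\<close>

theorem exists_approximate_arc:
  fixes F :: "'a::field pvpoly vec"
  assumes n: "n \<ge> 1" and F: "\<And>i. i < n \<Longrightarrow> indets (F $ i) \<subseteq> X ` {..<n}"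
    and root: "\<And>i. i < n \<Longrightarrow> meval (xpoint x) (F $ i) = 0"
    and det: "det (lin_block n F x) \<noteq> 0"
  obtains \<xi> where "\<xi> 0 = [:x $ 0, 1:]" "\<And>j. j < n \<Longrightarrow> coeff (\<xi> j) 0 = x $ j"
    "\<And>i k. i \<in> {1..<n} \<Longrightarrow> k < N \<Longrightarrow> coeff (pull_poly \<xi> (F $ i)) k = 0"
proof -
  have c0: "coeff (pull_poly \<xi> p) 0 = meval (xpoint x) p"
    if "indets p \<subseteq> X ` {..<n}" "\<And>j. j < n \<Longrightarrow> coeff (\<xi> j) 0 = x $ j" for \<xi> p
    using pull_nth_0[OF that(1), of "\<lambda>j. fps_of_poly (\<xi> j)" x] that(2) by (simp add: pull_fps_of_poly)
  have "\<exists>\<xi>. \<xi> 0 = [:x $ 0, 1:] \<and> (\<forall>j<n. coeff (\<xi> j) 0 = x $ j) \<and>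
    (\<forall>i\<in>{1..<n}. \<forall>k<N. coeff (pull_poly \<xi> (F $ i)) k = 0)"
  proof (induction N)
    case 0
    show ?case by (intro exI[of _ "\<lambda>j. if j = 0 then [:x $ 0, 1:] else [:x $ j:]"]) auto
  next
    case (Suc N)
    then obtain \<xi> where \<xi>: "\<xi> 0 = [:x $ 0, 1:]" "\<And>j. j < n \<Longrightarrow> coeff (\<xi> j) 0 = x $ j"
      "\<And>i k. i \<in> {1..<n} \<Longrightarrow> k < N \<Longrightarrow> coeff (pull_poly \<xi> (F $ i)) k = 0" by blast
    show ?case
    proof (cases "N = 0")
      case True
      have "coeff (pull_poly \<xi> (F $ i)) 0 = 0" if "i < n" for i
        using c0[OF F \<xi>(2)] root that by simp
      then show ?thesis using \<xi> True by (intro exI[of _ \<xi>]) auto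
    next
      case False
      obtain y where y: "\<And>i. i \<in> {1..<n} \<Longrightarrow>
          (\<Sum>j\<in>{1..<n}. meval (xpoint x) (mderiv (X j) (F $ i)) * y j) = - coeff (pull_poly \<xi> (F $ i)) N"
        using lower_block_solvable[OF det[unfolded lin_block_def],
            of "\<lambda>i. - coeff (pull_poly \<xi> (F $ i)) N"] by blast
      \<comment> \<open>The first coordinate is not corrected, so it remains \<open>x\<^sub>1 + t\<close>.\<close>
      define z where "z j = (if j = 0 then 0 else y j)" for j
      define \<zeta> where "\<zeta> j = \<xi> j + monom (z j) N" for j
      have "coeff (pull_poly \<zeta> (F $ i)) k = 0" if i: "i \<in> {1..<n}" and k: "k \<le> N" for i k
      proof -
        have "indets (F $ i) \<subseteq> X ` {..<n}" using F i by simp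
        then obtain s where s: "pull (\<lambda>j. fps_of_poly (\<zeta> j)) (F $ i)
            = pull (\<lambda>j. fps_of_poly (\<xi> j)) (F $ i) + fps_X ^ N * s"
          "fps_nth s 0 = (\<Sum>j<n. fps_nth (fps_const (z j)) 0 * meval (xpoint x) (mderiv (X j) (F $ i)))"
          by (rule pull_perturb[where k = N and r = "\<lambda>j. fps_const (z j)" and x = x
                and \<xi> = "\<lambda>j. fps_of_poly (\<xi> j)" and \<zeta> = "\<lambda>j. fps_of_poly (\<zeta> j)"])
             (use False \<xi>(2) in \<open>auto simp: \<zeta>_def fps_of_poly_add fps_of_poly_monom mult.commute\<close>)
        have "{..<n} = insert 0 {1..<n}" using n by auto
        then have "fps_nth s 0 = - coeff (pull_poly \<xi> (F $ i)) N"
          using s(2) y[OF i] by (simp add: z_def mult.commute cong: sum.cong_simp)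
        moreover have "coeff (pull_poly \<zeta> (F $ i)) k = coeff (pull_poly \<xi> (F $ i)) k + fps_nth (fps_X ^ N * s) k"
          using arg_cong[OF s(1), of "\<lambda>f. fps_nth f k"] by (simp add: pull_fps_of_poly)
        ultimately show ?thesis
          using \<xi>(3)[OF i, of k] k by (cases "k = N") (simp_all add: fps_X_power_mult_nth)
      qed
      moreover have "\<zeta> 0 = [:x $ 0, 1:]" "\<And>j. j < n \<Longrightarrow> coeff (\<zeta> j) 0 = x $ j"
        using \<xi> False by (simp_all add: \<zeta>_def z_def)
      ultimately show ?thesis by (intro exI[of _ \<zeta>]) (auto simp: less_Suc_eq_le)
    qed
  qed
  then show thesis using that by blast
qed

section \<open>Roots and Jacobian of the deflated system\<close>

lemma fps_deriv_pull:
  fixes p :: "'a::comm_ring_1 pvpoly"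
  assumes "indets p \<subseteq> X ` {..<n}"
  shows "fps_deriv (pull \<xi> p) = (\<Sum>j<n. fps_deriv (\<xi> j) * pull \<xi> (mderiv (X j) p))"
proof -
  interpret comm_ring_hom "fps_const :: 'a \<Rightarrow> _" by (rule comm_ring_hom_fps_const)
  have "fps_deriv (pull \<xi> p) = (\<Sum>v\<in>X ` {..<n}. fps_deriv (coords \<xi> v) * pull \<xi> (mderiv v p))"
    unfolding pull_def by (rule mpoly_subst_chain_rule) (simp_all add: assms)
  then show ?thesis by (simp add: sum_X_image)
qed

text \<open>The coefficients of the solution vanish successively, since only the constant terms of the
  matrix act on the lowest coefficient that is not yet known to vanish.\<close>

lemma fps_lower_system_trivial:
  fixes g :: "nat \<Rightarrow> nat \<Rightarrow> 'a::field fps"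
  assumes det: "det (lower_block n (\<lambda>i j. fps_nth (g i j) 0)) \<noteq> 0"
    and eq: "\<And>i k. i \<in> {1..<n} \<Longrightarrow> k < N \<Longrightarrow> fps_nth (\<Sum>j\<in>{1..<n}. y j * g i j) k = 0"
    and j: "j \<in> {1..<n}" and k: "k < N"
  shows "fps_nth (y j) k = 0"
  using k j
proof (induction k arbitrary: j rule: less_induct)
  case (less k)
  show ?case
  proof (rule lower_block_kernel_trivial[OF det less.prems(2), of "\<lambda>j. fps_nth (y j) k"])
    fix i assume i: "i \<in> {1..<n}"
    have "fps_nth (y j * g i j) k = fps_nth (g i j) 0 * fps_nth (y j) k" if "j \<in> {1..<n}" for j
    proof -
      have "fps_nth (y j * g i j) k = (\<Sum>l\<in>insert k {0..<k}. fps_nth (y j) l * fps_nth (g i j) (k - l))"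
        unfolding fps_mult_nth by (rule sum.cong) auto
      also have "\<dots> = fps_nth (y j) k * fps_nth (g i j) 0"
        using less.IH less.prems(1) that by (subst sum.insert) simp_all
      finally show ?thesis by (simp add: mult.commute)
    qed
    then show "(\<Sum>j\<in>{1..<n}. fps_nth (g i j) 0 * fps_nth (y j) k) = 0"
      using eq[OF i less.prems(1)] by (simp add: fps_sum_nth)
  qed
qed

text \<open>The sum is the polynomial with coefficients \<open>c\<close> composed with a translation, which preserves
  the degree and is injective.\<close>

lemma shifted_powers_independent:
  fixes c :: "nat \<Rightarrow> 'a::field" and a :: 'a and m :: nat
  defines "S \<equiv> (\<Sum>\<nu><m. fps_const (c \<nu>) * (fps_const a + fps_X) ^ \<nu>)"
  shows "fps_nth S m = 0" "(\<And>k. k < m \<Longrightarrow> fps_nth S k = 0) \<Longrightarrow> \<nu> < m \<Longrightarrow> c \<nu> = 0"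
proof -
  define p where "p = (\<Sum>\<nu><m. monom (c \<nu>) \<nu>)"
  have coeff_p: "coeff p \<nu> = (if \<nu> < m then c \<nu> else 0)" for \<nu>
    by (simp add: p_def coeff_sum)
  have S: "S = fps_of_poly (pcompose p [:a, 1:])"
  proof -
    have monom: "pcompose (monom b k) q = smult b (q ^ k)" for b k and q :: "'a poly"
      by (induction k) (simp_all add: monom_0 monom_Suc pcompose_pCons)
    have "pcompose p [:a, 1:] = (\<Sum>\<nu><m. smult (c \<nu>) ([:a, 1:] ^ \<nu>))"
      unfolding p_def pcompose_sum
      by (simp add: monom)
    then show ?thesis
      by (simp add: S_def fps_of_poly_sum fps_of_poly_smult fps_of_poly_power fps_of_poly_pCons)
  qed
  have vanish: "coeff (pcompose p [:a, 1:]) k = 0" if "k \<ge> m" for k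
  proof (cases "m = 0")
    case True
    then show ?thesis by (simp add: p_def)
  next
    case False
    then have "degree p < m" using coeff_p by (intro degree_lessI) auto
    then show ?thesis using that by (intro coeff_eq_0) (simp add: degree_pcompose)
  qed
  then show "fps_nth S m = 0" by (simp add: S)
  assume "\<And>k. k < m \<Longrightarrow> fps_nth S k = 0" and "\<nu> < m"
  then have "pcompose p [:a, 1:] = 0"
    using vanish by (intro poly_eqI) (simp add: S, meson not_less)
  then have "p = 0" by (simp add: pcompose_eq_0_iff)
  then show "c \<nu> = 0" using coeff_p[of \<nu>] \<open>\<nu> < m\<close> by simp
qed

text \<open>An arc along which $f_2, \ldots, f_n$ vanish to an order beyond \<open>\<mu>\<close> and $f_1$ exactly to
  order \<open>\<mu>\<close>. For the lower equations the order \<open>\<mu>\<close> itself is included, because the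
  argument differentiates along the arc once.\<close>

locale solution_arc =
  fixes n \<mu> :: nat and F :: "'a::field_char_0 pvpoly vec" and x :: "'a vec" and \<xi> :: "nat \<Rightarrow> 'a fps"
  assumes n: "n \<ge> 1" and F: "\<And>i. i < n \<Longrightarrow> indets (F $ i) \<subseteq> X ` {..<n}"
    and F_dim: "F \<in> carrier_vec n"
    and det: "det (lin_block n F x) \<noteq> 0"
    and arc_0: "\<xi> 0 = fps_const (x $ 0) + fps_X"
    and arc_x: "\<And>j. j < n \<Longrightarrow> fps_nth (\<xi> j) 0 = x $ j"
    and mu: "\<mu> \<ge> 2"
    and lower: "\<And>i k. i \<in> {1..<n} \<Longrightarrow> k \<le> \<mu> \<Longrightarrow> fps_nth (pull \<xi> (F $ i)) k = 0"
    and first: "\<And>k. k < \<mu> \<Longrightarrow> fps_nth (pull \<xi> (F $ 0)) k = 0"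
    and first_mu: "fps_nth (pull \<xi> (F $ 0)) \<mu> \<noteq> 0"
begin

text \<open>This is the nonsingularity of the deflated Jacobian in terms of power series: \<open>y\<close> is the
  variation of the arc and \<open>c\<close> that of the smoothing parameters.\<close>

lemma linearized_system_trivial:
  assumes y0: "y 0 = fps_const s"
    and eq: "\<And>i k. i < n \<Longrightarrow> k < \<mu> \<Longrightarrow> fps_nth (\<Sum>j<n. y j * pull \<xi> (mderiv (X j) (F $ i))) k
      = (if i = 0 then fps_nth (\<Sum>\<nu><\<mu> - 1. fps_const (c \<nu>) * (fps_const (x $ 0) + fps_X) ^ \<nu>) k else 0)"
  shows "\<And>\<nu>. \<nu> < \<mu> - 1 \<Longrightarrow> c \<nu> = 0" "\<And>j k. j < n \<Longrightarrow> k < \<mu> \<Longrightarrow> fps_nth (y j) k = 0"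
proof -
  define S where "S = (\<Sum>\<nu><\<mu> - 1. fps_const (c \<nu>) * (fps_const (x $ 0) + fps_X) ^ \<nu>)"
  define g where "g i j = pull \<xi> (mderiv (X j) (F $ i))" for i j
  \<comment> \<open>The derivative of the arc solves the homogeneous lower equations and has first coordinate 1.\<close>
  define z where "z j = y j - fps_const s * fps_deriv (\<xi> j)" for j
  have z0: "z 0 = 0" by (simp add: z_def y0 arc_0)
  have split: "{..<n} = insert 0 {1..<n}" using n by auto
  have zeq: "fps_nth (\<Sum>j\<in>{1..<n}. z j * g i j) k
      = (if i = 0 then fps_nth S k else 0) - s * (of_nat (Suc k) * fps_nth (pull \<xi> (F $ i)) (Suc k))"
    if "i < n" "k < \<mu>" for i k
  proof -
    have "(\<Sum>j\<in>{1..<n}. z j * g i j) = (\<Sum>j<n. z j * g i j)"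
      unfolding split by (simp add: z0)
    also have "\<dots> = (\<Sum>j<n. y j * g i j) - fps_const s * (\<Sum>j<n. fps_deriv (\<xi> j) * g i j)"
      by (simp add: z_def left_diff_distrib sum_subtractf sum_distrib_left mult.assoc)
    also have "(\<Sum>j<n. fps_deriv (\<xi> j) * g i j) = fps_deriv (pull \<xi> (F $ i))"
      unfolding g_def by (rule fps_deriv_pull[symmetric]) (rule F[OF that(1)])
    finally show ?thesis
      using eq[OF that] unfolding g_def S_def by (simp add: add.commute)
  qed
  have g0: "fps_nth (g i j) 0 = meval (xpoint x) (mderiv (X j) (F $ i))" if "i < n" for i j
    unfolding g_def using indets_mderiv[of "X j" "F $ i"] F[OF that] by (intro pull_nth_0 arc_x) auto
  have "lower_block n (\<lambda>i j. fps_nth (g i j) 0) = lin_block n F x"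
    unfolding lin_block_def lower_block_def by (rule eq_matI) (auto simp: g0)
  with det have det_g: "det (lower_block n (\<lambda>i j. fps_nth (g i j) 0)) \<noteq> 0" by simp
  have z: "fps_nth (z j) k = 0" if "j < n" "k < \<mu>" for j k
  proof (cases "j = 0")
    case True
    then show ?thesis by (simp add: z0)
  next
    case False
    have "fps_nth (\<Sum>j\<in>{1..<n}. z j * g i j) k = 0" if "i \<in> {1..<n}" "k < \<mu>" for i k
      using zeq[of i k] that lower[of i "Suc k"] by simp
    from fps_lower_system_trivial[of n g \<mu> z, OF det_g this] show ?thesis
      using that False by simp
  qed
  have S: "fps_nth S k = s * (of_nat (Suc k) * fps_nth (pull \<xi> (F $ 0)) (Suc k))" if "k < \<mu>" for k
  proof -
    have "fps_nth (z j * g 0 j) k = 0" if "j \<in> {1..<n}" for j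
      unfolding fps_mult_nth using z that \<open>k < \<mu>\<close> by (intro sum.neutral) auto
    then have "fps_nth (\<Sum>j\<in>{1..<n}. z j * g 0 j) k = 0" by (simp add: fps_sum_nth)
    with zeq[of 0 k] n that show ?thesis by simp
  qed
  \<comment> \<open>The smoothing term has degree at most \<open>\<mu> - 2\<close>, whereas the derivative of \<open>f\<^sub>1\<close> along the
    arc has order exactly \<open>\<mu> - 1\<close>.\<close>
  have "fps_nth S (\<mu> - 1) = 0"
    unfolding S_def by (rule shifted_powers_independent)
  then have s: "s = 0"
    using S[of "\<mu> - 1"] mu first_mu by simp
  then show "fps_nth (y j) k = 0" if "j < n" "k < \<mu>" for j k
    using z[OF that] by (simp add: z_def)
  show "c \<nu> = 0" if "\<nu> < \<mu> - 1" for \<nu>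
    by (rule shifted_powers_independent(2)[of "\<mu> - 1" c "x $ 0", OF _ that])
       (use S s in \<open>simp add: S_def\<close>)
qed

end

lemma deflated_block_eq_along_arc:
  assumes "i < n"
  shows "deflated_block n \<mu> F (Suc k) $ i = fps_nth (along_arc n (perturbed n \<mu> F $ i)) k"
  using assms Lop_eq_along_arc[where k = "Suc k" and n = n and i = i and H = "perturbed n \<mu> F"]
  by (cases "k = 0") (simp_all add: deflated_block_def along_arc_0)

definition smoothing :: "nat \<Rightarrow> 'a::field_char_0 pvpoly" where
  "smoothing \<mu> = (\<Sum>\<nu><\<mu> - 1. mConst (1 / fact \<nu>) * mVar (B \<nu>) * mVar (X 0) ^ \<nu>)"

lemma perturbed_nth:
  "F \<in> carrier_vec n \<Longrightarrow> i < n \<Longrightarrow> perturbed n \<mu> F $ i = F $ i - (if i = 0 then smoothing \<mu> else 0)"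
  by (simp add: perturbed_def smoothing_def)

lemma indets_smoothing:
  assumes "n \<ge> 1"
  shows "indets (smoothing \<mu> :: 'a::field_char_0 pvpoly) \<subseteq> X ` {..<n} \<union> B ` {..<\<mu> - 1}"
  unfolding smoothing_def
proof (rule indets_sum)
  fix \<nu> assume \<nu>: "\<nu> \<in> {..<\<mu> - 1}"
  have "indets (mVar (X 0) ^ \<nu> :: 'a pvpoly) \<subseteq> {X 0}" by (rule indets_power) simp
  moreover have "indets (mConst (1 / fact \<nu>) * mVar (B \<nu>) :: 'a pvpoly) \<subseteq> {B \<nu>}"
    using indets_mult[of "mConst (1 / fact \<nu>) :: 'a pvpoly" "mVar (B \<nu>)"] by simp
  moreover have "X 0 \<in> X ` {..<n}" using assms by simp
  ultimately show "indets (mConst (1 / fact \<nu>) * mVar (B \<nu>) * mVar (X 0) ^ \<nu> :: 'a pvpoly)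
      \<subseteq> X ` {..<n} \<union> B ` {..<\<mu> - 1}"
    using \<nu> indets_mult[of "mConst (1 / fact \<nu>) * mVar (B \<nu>) :: 'a pvpoly" "mVar (X 0) ^ \<nu>"] by blast
qed

text \<open>The arc encoded by the values \<open>a\<close> of the unknowns: \<open>a (Suc k, j)\<close> is the coefficient of
  \<open>t\<^sup>k\<close>. Only the coefficients below \<open>t\<^sup>\<mu>\<close> are meaningful, the values of \<open>a\<close> for larger
  first indices being arbitrary.\<close>

definition arc_of :: "'a::field_char_0 vec \<Rightarrow> (nat \<times> nat \<Rightarrow> 'a) \<Rightarrow> nat \<Rightarrow> 'a fps" where
  "arc_of x a j = (if j = 0 then fps_const (x $ 0) + fps_X
     else Abs_fps (\<lambda>k. if k = 0 then x $ j else a (Suc k, j)))"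

context
  fixes n :: nat and x :: "'a::field_char_0 vec" and a :: "nat \<times> nat \<Rightarrow> 'a"
begin

text \<open>Expansion along the generic arc followed by specialization of the unknowns, with all
  smoothing parameters set to zero. It is a ring homomorphism, hence determined by its values on
  constants and variables.\<close>

definition at_arc :: "'a pvpoly \<Rightarrow> 'a fps" where
  "at_arc p = fps_map (meval (point x (\<lambda>_. 0) a)) (along_arc n p)"

lemma comm_ring_hom_along_arc: "comm_ring_hom (along_arc n :: 'a pvpoly \<Rightarrow> _)"
  unfolding along_arc_def
  by (rule comm_ring_hom.comm_ring_hom_mpoly_subst[OF comm_ring_hom_fps_const_mConst])

lemma comm_ring_hom_at_arc: "comm_ring_hom at_arc"
  unfolding at_arc_def
  by (rule comm_ring_hom_comp[OF comm_ring_hom_fps_map[OF comm_ring_hom_meval] comm_ring_hom_along_arc])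

lemma at_arc_mVar: "at_arc (mVar v) = fps_map (meval (point x (\<lambda>_. 0) a)) (generic_arc n v)"
  unfolding at_arc_def along_arc_def
  by (simp add: comm_ring_hom.mpoly_subst_mVar[OF comm_ring_hom_fps_const_mConst])

lemma at_arc_mConst: "at_arc (mConst c) = fps_const c"
proof -
  interpret comm_ring_hom "meval (point x (\<lambda>_. 0) a)" by (rule comm_ring_hom_meval)
  show ?thesis
    unfolding at_arc_def along_arc_def
    by (simp add: comm_ring_hom.mpoly_subst_mConst[OF comm_ring_hom_fps_const_mConst] fps_eq_iff
        meval_mConst)
qed

lemma at_arc_B: "at_arc (mVar (B \<nu>)) = 0"
proof -
  interpret comm_ring_hom "meval (point x (\<lambda>_. 0) a)" by (rule comm_ring_hom_meval)
  show ?thesis by (simp add: at_arc_mVar fps_eq_iff meval_mVar)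
qed

lemma at_arc_X:
  assumes "j < n"
  shows "at_arc (mVar (X j)) = arc_of x a j"
proof -
  interpret comm_ring_hom "meval (point x (\<lambda>_. 0) a)" by (rule comm_ring_hom_meval)
  show ?thesis
    using assms by (auto simp: at_arc_mVar fps_eq_iff meval_mVar arc_of_def avec_def)
qed

lemma at_arc_eq_pull:
  assumes "indets p \<subseteq> X ` {..<n}"
  shows "at_arc p = pull (arc_of x a) p"
proof -
  interpret at: comm_ring_hom at_arc by (rule comm_ring_hom_at_arc)
  interpret pull: comm_ring_hom "pull (arc_of x a)" by (rule comm_ring_hom_pull)
  show ?thesis using assms
  proof (induction p rule: mpoly_induct)
    case (const c)
    then show ?case
      by (simp add: at_arc_mConst pull_def comm_ring_hom.mpoly_subst_mConst[OF comm_ring_hom_fps_const])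
  next
    case (var v)
    then show ?case
      by (auto simp: at_arc_X pull_def comm_ring_hom.mpoly_subst_mVar[OF comm_ring_hom_fps_const])
  qed (simp_all add: at.hom_add at.hom_mult pull.hom_add pull.hom_mult)
qed

lemma at_arc_smoothing: "at_arc (smoothing \<mu>) = 0"
  and at_arc_mderiv_X_smoothing: "at_arc (mderiv (X j) (smoothing \<mu>)) = 0"
proof -
  interpret at: comm_ring_hom at_arc by (rule comm_ring_hom_at_arc)
  show "at_arc (smoothing \<mu>) = 0"
    unfolding smoothing_def at.hom_sum at.hom_mult at_arc_B by simp
  show "at_arc (mderiv (X j) (smoothing \<mu>)) = 0"
    unfolding smoothing_def mderiv_sum mderiv_mult mderiv_mConst mderiv_mVar
    by (simp add: at.hom_sum at.hom_mult at.hom_add at_arc_B)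
qed

lemma at_arc_mderiv_B_smoothing:
  assumes "\<nu> < \<mu> - 1" "n \<ge> 1"
  shows "at_arc (mderiv (B \<nu>) (smoothing \<mu>)) = fps_const (1 / fact \<nu>) * (fps_const (x $ 0) + fps_X) ^ \<nu>"
proof -
  interpret at: comm_ring_hom at_arc by (rule comm_ring_hom_at_arc)
  have pow: "mderiv (B \<nu>) (mVar (X 0) ^ k :: 'a pvpoly) = 0" for k
    by (induction k) (simp_all add: mderiv_mult mderiv_mVar)
  have "mderiv (B \<nu>) (smoothing \<mu>) =
      (\<Sum>\<kappa><\<mu> - 1. if \<kappa> = \<nu> then mConst (1 / fact \<nu>) * mVar (X 0) ^ \<nu> else (0 :: 'a pvpoly))"
    unfolding smoothing_def mderiv_sum
    by (intro sum.cong) (simp_all add: mderiv_mult pow mderiv_mVar)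
  then show ?thesis
    using assms by (simp add: at.hom_mult at.hom_power at_arc_mConst at_arc_X arc_of_def)
qed

end

lemma at_arc_perturbed:
  assumes "F \<in> carrier_vec n" "i < n" "indets (F $ i) \<subseteq> X ` {..<n}"
  shows "at_arc n x a (perturbed n \<mu> F $ i) = pull (arc_of x a) (F $ i)"
proof -
  interpret at: comm_ring_hom "at_arc n x a" by (rule comm_ring_hom_at_arc)
  show ?thesis
    by (simp add: perturbed_nth[OF assms(1,2)] at.hom_minus at_arc_smoothing at_arc_eq_pull[OF assms(3)])
qed

lemma all_block_index:
  "(\<forall>r<\<mu> * n. P (r div n) (r mod n)) \<longleftrightarrow> (\<forall>k<\<mu>. \<forall>i<n. P k i)" for n :: nat
proof (intro iffI allI impI)
  fix r assume *: "\<forall>k<\<mu>. \<forall>i<n. P k i" and r: "r < \<mu> * n"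
  then have "r div n < \<mu>" "r mod n < n"
    by (simp_all add: less_mult_imp_div_less) (metis mod_less_divisor mult_0_right not_gr0 not_less_zero)
  with * show "P (r div n) (r mod n)" by blast
next
  fix k i assume *: "\<forall>r<\<mu> * n. P (r div n) (r mod n)" and k: "k < \<mu>" and i: "i < n"
  have "k * n + i < Suc k * n" using i by simp
  also have "\<dots> \<le> \<mu> * n" using k by (intro mult_right_mono) auto
  finally show "P k i" using * i by (metis add.commute add_cancel_left_right div_mult_self3 div_less
        mod_mult_self3 mod_less not_less_zero mult.commute)
qed

lemma deflated_nth:
  assumes "r < \<mu> * n"
  shows "deflated n \<mu> F $ r = fps_nth (along_arc n (perturbed n \<mu> F $ (r mod n))) (r div n)"
proof -
  have "r mod n < n" using assms by (metis mod_less_divisor mult_0_right not_gr0 not_less_zero)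
  then show ?thesis
    using assms deflated_block_eq_along_arc[of "r mod n" n \<mu> F "r div n"] by (simp add: deflated_def)
qed

text \<open>The equations of the deflated system at \<open>b = 0\<close> are the coefficients of $F$ along the
  arc below $t^\mu$.\<close>

lemma deflated_root_iff:
  assumes "F \<in> carrier_vec n" "\<And>i. i < n \<Longrightarrow> indets (F $ i) \<subseteq> X ` {..<n}"
  shows "deflated_root n \<mu> F x (\<lambda>_. 0) a
    \<longleftrightarrow> (\<forall>k<\<mu>. \<forall>i<n. fps_nth (pull (arc_of x a) (F $ i)) k = 0)"
proof -
  have "deflated_root n \<mu> F x (\<lambda>_. 0) a
      \<longleftrightarrow> (\<forall>r<\<mu> * n. meval (point x (\<lambda>_. 0) a) (deflated n \<mu> F $ r) = 0)"
    unfolding deflated_root_def by (auto simp: vec_eq_iff deflated_def)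
  also have "\<dots> \<longleftrightarrow> (\<forall>r<\<mu> * n. fps_nth (at_arc n x a (perturbed n \<mu> F $ (r mod n))) (r div n) = 0)"
    by (simp add: deflated_nth at_arc_def)
  also have "\<dots> \<longleftrightarrow> (\<forall>k<\<mu>. \<forall>i<n. fps_nth (at_arc n x a (perturbed n \<mu> F $ i)) k = 0)"
    by (rule all_block_index)
  also have "\<dots> \<longleftrightarrow> (\<forall>k<\<mu>. \<forall>i<n. fps_nth (pull (arc_of x a) (F $ i)) k = 0)"
    using assms by (simp add: at_arc_perturbed)
  finally show ?thesis .
qed

lemma set_deflated_vars:
  "set (deflated_vars n \<mu>) = X ` {..<n} \<union> B ` {..<\<mu> - 1} \<union> {A k j | k j. k \<in> {2..\<mu>} \<and> j \<in> {1..<n}}"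
  by (auto simp: deflated_vars_def)

lemma distinct_deflated_vars: "distinct (deflated_vars n \<mu>)"
proof -
  have "distinct (concat (map (\<lambda>k. map (A k) [1..<n]) ks))" if "distinct ks" for ks
    using that by (induction ks) (auto simp: distinct_map inj_on_def)
  then show ?thesis
    by (auto simp: deflated_vars_def distinct_map inj_on_def simp del: upt_Suc)
qed

lemma length_deflated_vars:
  assumes "n \<ge> 1" "\<mu> \<ge> 1"
  shows "length (deflated_vars n \<mu>) = \<mu> * n"
proof -
  have "length (concat (map (\<lambda>k. map (A k) [1..<n]) ks)) = length ks * (n - 1)" for ks
    by (induction ks) simp_all
  then have "length (deflated_vars n \<mu>) = n + (\<mu> - 1) + (\<mu> - 1) * (n - 1)"
    by (simp add: deflated_vars_def del: upt_Suc)
  also have "\<dots> = \<mu> * n"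
    using assms by (cases \<mu>; cases n) simp_all
  finally show ?thesis .
qed

context solution_arc
begin

text \<open>Both arcs annihilate the lower equations modulo $t^\mu$, and uniqueness applies.\<close>

lemma arc_of_agrees:
  assumes root: "deflated_root n \<mu> F x (\<lambda>_. 0) a" and "j < n" "k < \<mu>"
  shows "fps_nth (arc_of x a j) k = fps_nth (\<xi> j) k"
proof (rule pull_lower_unique[where F = F and n = n and x = x and N = \<mu>, OF F det])
  show "fps_nth (arc_of x a j) 0 = x $ j" if "j < n" for j by (simp add: arc_of_def)
  show "fps_nth (pull (arc_of x a) (F $ i)) k = fps_nth (pull \<xi> (F $ i)) k"
    if "i \<in> {1..<n}" "k < \<mu>" for i k
    using that root lower[of i k] F F_dim by (simp add: deflated_root_iff)
qed (use assms arc_x arc_0 in \<open>auto simp: arc_of_def\<close>)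

theorem deflated_root_unique: "\<exists>!a. a \<in> a_values n \<mu> \<and> deflated_root n \<mu> F x (\<lambda>_. 0) a"
proof
  define a where "a = (\<lambda>(k, j) \<in> {2..\<mu>} \<times> {1..<n}. fps_nth (\<xi> j) (k - 1))"
  have agree: "fps_nth (arc_of x a j) k = fps_nth (\<xi> j) k" if "j < n" "k < \<mu>" for j k
    using that arc_x arc_0 by (auto simp: arc_of_def a_def)
  have "fps_nth (pull (arc_of x a) (F $ i)) k = 0" if "k < \<mu>" "i < n" for i k
  proof -
    have "fps_nth (pull (arc_of x a) (F $ i)) k = fps_nth (pull \<xi> (F $ i)) k"
      by (rule pull_cong_upto[where n = n and k = \<mu>]) (use F agree that in auto)
    then show ?thesis using lower[of i k] first[of k] that by (cases "i = 0") auto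
  qed
  then show "a \<in> a_values n \<mu> \<and> deflated_root n \<mu> F x (\<lambda>_. 0) a"
    using F F_dim by (auto simp: deflated_root_iff a_values_def a_def)
  fix a' assume a': "a' \<in> a_values n \<mu> \<and> deflated_root n \<mu> F x (\<lambda>_. 0) a'"
  show "a' = a"
  proof (rule PiE_ext)
    show "a' \<in> ({2..\<mu>} \<times> {1..<n}) \<rightarrow>\<^sub>E UNIV" "a \<in> ({2..\<mu>} \<times> {1..<n}) \<rightarrow>\<^sub>E UNIV"
      using a' by (auto simp: a_values_def a_def)
    fix kj assume "kj \<in> {2..\<mu>} \<times> {1..<n}"
    then obtain k j where kj: "kj = (k, j)" "2 \<le> k" "k \<le> \<mu>" "1 \<le> j" "j < n" by auto
    have "fps_nth (arc_of x a' j) (k - 1) = fps_nth (\<xi> j) (k - 1)"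
      using a' kj by (intro arc_of_agrees) auto
    then show "a' kj = a kj" using kj by (simp add: arc_of_def a_def)
  qed
qed

text \<open>The first order variation of the arc in the direction \<open>w\<close>. Its first coordinate is
  constant, because the arc has first coordinate \<open>x\<^sub>1 + t\<close> for all values of the unknowns.\<close>

definition velocity :: "(pvar \<Rightarrow> 'a) \<Rightarrow> nat \<Rightarrow> 'a fps" where
  "velocity w j = Abs_fps (\<lambda>k. if k = 0 then w (X j) else if j = 0 then 0 else w (A (Suc k) j))"

text \<open>A kernel vector assigns to every variable an increment; the rows say that the resulting
  variations of the arc and of the smoothing parameters solve the linearized system.\<close>

theorem deflated_jacobian_invertible:
  assumes root: "deflated_root n \<mu> F x (\<lambda>_. 0) a"
  shows "invertible_mat (map_mat (meval (point x (\<lambda>_. 0) a)) (deflated_jacobian n \<mu> F))"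
proof (rule invertible_mat_if_trivial_kernel)
  let ?dv = "deflated_vars n \<mu>" and ?ev = "meval (point x (\<lambda>_. 0) a)"
  let ?T = "map_mat ?ev (deflated_jacobian n \<mu> F)"
  let ?V = "X ` {..<n} \<union> B ` {..<\<mu> - 1}"
  show "?T \<in> carrier_mat (\<mu> * n) (\<mu> * n)" by (simp add: deflated_jacobian_def)
  fix v assume v: "v \<in> carrier_vec (\<mu> * n)" and ker: "?T *\<^sub>v v = 0\<^sub>v (\<mu> * n)"
  have bij: "bij_betw ((!) ?dv) {..<\<mu> * n} (set ?dv)"
    using length_deflated_vars[OF n, of \<mu>] mu by (intro bij_betw_nth distinct_deflated_vars) auto
  define w where "w u = (if u \<in> set ?dv then v $ inv_into {..<\<mu> * n} ((!) ?dv) u else 0)" for u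
  have w_nth: "w (?dv ! c) = v $ c" if "c < \<mu> * n" for c
  proof -
    have "?dv ! c \<in> set ?dv" using bij_betwE[OF bij] that by blast
    then show ?thesis using that bij by (simp add: w_def bij_betw_def inv_into_f_f)
  qed
  interpret ev: comm_ring_hom ?ev by (rule comm_ring_hom_meval)
  interpret evf: comm_ring_hom "fps_map ?ev" by (rule comm_ring_hom_fps_map[OF comm_ring_hom_meval])
  interpret at: comm_ring_hom "at_arc n x a" by (rule comm_ring_hom_at_arc)
  \<comment> \<open>The variation of the generic arc coordinate \<open>u\<close> caused by the increments \<open>w\<close>.\<close>
  define vel where "vel u = (\<Sum>u'\<in>set ?dv. fps_const (w u') * fps_map ?ev (fps_map (mderiv u') (generic_arc n u)))" for u
  have ind: "indets (perturbed n \<mu> F $ i) \<subseteq> ?V" if "i < n" for i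
    using indets_diff[of "F $ i" "smoothing \<mu>"] indets_smoothing[OF n, of \<mu>] F[OF that]
    by (auto simp: perturbed_nth[OF F_dim that])
  have kernel: "fps_nth (\<Sum>u\<in>?V. vel u * at_arc n x a (mderiv u (perturbed n \<mu> F $ i))) k = 0"
    if "k < \<mu>" "i < n" for i k
  proof -
    let ?p = "perturbed n \<mu> F $ i"
    have "\<forall>r<\<mu> * n. (\<Sum>u\<in>set ?dv. w u * ?ev (mderiv u (fps_nth (along_arc n (perturbed n \<mu> F $ (r mod n))) (r div n)))) = 0"
    proof (intro allI impI)
      fix r assume r: "r < \<mu> * n"
      have "0 = (?T *\<^sub>v v) $ r" using ker r by simp
      also have "\<dots> = (\<Sum>c<\<mu> * n. ?ev (mderiv (?dv ! c) (deflated n \<mu> F $ r)) * v $ c)"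
        using r v by (simp add: deflated_jacobian_def scalar_prod_def lessThan_atLeast0)
      also have "\<dots> = (\<Sum>c<\<mu> * n. ?ev (mderiv (?dv ! c) (deflated n \<mu> F $ r)) * w (?dv ! c))"
        by (simp add: w_nth)
      also have "\<dots> = (\<Sum>u\<in>set ?dv. ?ev (mderiv u (deflated n \<mu> F $ r)) * w u)"
        by (rule sum.reindex_bij_betw[OF bij])
      finally show "(\<Sum>u\<in>set ?dv. w u * ?ev (mderiv u (fps_nth (along_arc n (perturbed n \<mu> F $ (r mod n))) (r div n)))) = 0"
        by (simp add: deflated_nth[OF r] mult.commute)
    qed
    then have "0 = (\<Sum>u\<in>set ?dv. w u * ?ev (mderiv u (fps_nth (along_arc n ?p) k)))"
      using that by (subst (asm) all_block_index[where P = "\<lambda>k i.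
          (\<Sum>u\<in>set ?dv. w u * ?ev (mderiv u (fps_nth (along_arc n (perturbed n \<mu> F $ i)) k))) = 0"]) simp
    also have "\<dots> = fps_nth (\<Sum>u\<in>set ?dv. fps_const (w u) * fps_map ?ev (fps_map (mderiv u) (along_arc n ?p))) k"
      by (simp add: fps_sum_nth)
    also have "(\<Sum>u\<in>set ?dv. fps_const (w u) * fps_map ?ev (fps_map (mderiv u) (along_arc n ?p)))
        = (\<Sum>u\<in>set ?dv. \<Sum>u'\<in>?V. fps_const (w u) * fps_map ?ev (fps_map (mderiv u) (generic_arc n u')) * at_arc n x a (mderiv u' ?p))"
      by (subst fps_map_mderiv_along_arc[of ?V])
         (use ind[OF that(2)] in \<open>simp_all add: evf.hom_sum evf.hom_mult sum_distrib_left mult.assoc at_arc_def\<close>)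
    also have "\<dots> = (\<Sum>u'\<in>?V. vel u' * at_arc n x a (mderiv u' ?p))"
      by (subst sum.swap) (simp add: vel_def sum_distrib_right)
    finally show ?thesis by simp
  qed
  have select: "(\<Sum>u\<in>set ?dv. w u * ?ev (mderiv u (mVar u'))) = w u'" for u'
  proof -
    have "w u * ?ev (mderiv u (mVar u')) = (if u = u' then w u else 0)" for u
      by (simp add: mderiv_mVar)
    then show ?thesis by simp (simp add: w_def)
  qed
  have vel_X: "vel (X j) = velocity w j" if "j < n" for j
    using that by (auto simp: vel_def velocity_def fps_eq_iff fps_sum_nth select avec_def)
  have vel_B: "vel (B \<nu>) = fps_const (w (B \<nu>))" for \<nu>
    by (auto simp: vel_def fps_eq_iff fps_sum_nth select)
  have sys: "fps_nth (\<Sum>j<n. velocity w j * pull \<xi> (mderiv (X j) (F $ i))) k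
      = (if i = 0 then fps_nth (\<Sum>\<nu><\<mu> - 1. fps_const (w (B \<nu>) / fact \<nu>) * (fps_const (x $ 0) + fps_X) ^ \<nu>) k else 0)"
    if "i < n" "k < \<mu>" for i k
  proof -
    have indX: "indets (mderiv (X j) (F $ i)) \<subseteq> X ` {..<n}" for j
      using indets_mderiv[of "X j" "F $ i"] F[OF that(1)] by blast
    have dX: "at_arc n x a (mderiv (X j) (perturbed n \<mu> F $ i)) = pull (arc_of x a) (mderiv (X j) (F $ i))" for j
      by (simp add: perturbed_nth[OF F_dim that(1)] mderiv_diff at.hom_minus at_arc_mderiv_X_smoothing
          at_arc_eq_pull[OF indX])
    have "mderiv (B \<nu>) (F $ i) = 0" for \<nu>
    proof -
      have "indets p \<subseteq> X ` {..<n} \<Longrightarrow> mderiv (B \<nu>) p = 0" for p :: "'a pvpoly"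
        by (induction p rule: mpoly_induct) (auto simp: mderiv_mVar mderiv_add mderiv_mult)
      then show ?thesis using F[OF that(1)] .
    qed
    then have dB: "at_arc n x a (mderiv (B \<nu>) (perturbed n \<mu> F $ i))
        = (if i = 0 then - (fps_const (1 / fact \<nu>) * (fps_const (x $ 0) + fps_X) ^ \<nu>) else 0)"
      if "\<nu> < \<mu> - 1" for \<nu>
      using at_arc_mderiv_B_smoothing[OF that n, of x a]
      by (simp add: perturbed_nth[OF F_dim \<open>i < n\<close>] mderiv_diff at.hom_minus at.hom_uminus)
    have "0 = fps_nth (\<Sum>u\<in>?V. vel u * at_arc n x a (mderiv u (perturbed n \<mu> F $ i))) k"
      using kernel[OF that(2,1)] by simp
    also have "(\<Sum>u\<in>?V. vel u * at_arc n x a (mderiv u (perturbed n \<mu> F $ i)))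
        = (\<Sum>j<n. velocity w j * pull (arc_of x a) (mderiv (X j) (F $ i)))
        + (\<Sum>\<nu><\<mu> - 1. fps_const (w (B \<nu>)) * at_arc n x a (mderiv (B \<nu>) (perturbed n \<mu> F $ i)))"
      by (subst sum.union_disjoint) (auto simp: sum_X_image sum.reindex inj_on_def vel_X vel_B dX)
    also have "(\<Sum>\<nu><\<mu> - 1. fps_const (w (B \<nu>)) * at_arc n x a (mderiv (B \<nu>) (perturbed n \<mu> F $ i)))
        = - (if i = 0 then \<Sum>\<nu><\<mu> - 1. fps_const (w (B \<nu>) / fact \<nu>) * (fps_const (x $ 0) + fps_X) ^ \<nu> else 0)"
      by (simp add: dB sum_negf mult.assoc[symmetric])
    also have "fps_nth ((\<Sum>j<n. velocity w j * pull (arc_of x a) (mderiv (X j) (F $ i)))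
        + - (if i = 0 then \<Sum>\<nu><\<mu> - 1. fps_const (w (B \<nu>) / fact \<nu>) * (fps_const (x $ 0) + fps_X) ^ \<nu> else 0)) k
      = fps_nth (\<Sum>j<n. velocity w j * pull \<xi> (mderiv (X j) (F $ i))) k
        - fps_nth (if i = 0 then \<Sum>\<nu><\<mu> - 1. fps_const (w (B \<nu>) / fact \<nu>) * (fps_const (x $ 0) + fps_X) ^ \<nu> else 0) k"
    proof -
      \<comment> \<open>Below order \<open>\<mu>\<close> the arc of the root may be replaced by the reference arc.\<close>
      have "fps_nth (velocity w j * pull (arc_of x a) (mderiv (X j) (F $ i))) k
          = fps_nth (velocity w j * pull \<xi> (mderiv (X j) (F $ i))) k" for j
        unfolding fps_mult_nth
        using that arc_of_agrees[OF root] pull_cong_upto[OF indX, of \<mu> "arc_of x a" \<xi>]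
        by (intro sum.cong) auto
      then show ?thesis by (simp add: fps_sum_nth)
    qed
    finally show ?thesis by (simp split: if_splits)
  qed
  have "velocity w 0 = fps_const (w (X 0))" by (simp add: velocity_def fps_eq_iff)
  note triv = linearized_system_trivial[where y = "velocity w", OF this sys]
  have "w (B \<nu>) = 0" if "\<nu> < \<mu> - 1" for \<nu>
    using triv(1)[OF _ _ that] by simp
  moreover have "w (X j) = 0" if "j < n" for j
    using triv(2)[OF _ _ that, of 0] mu by (simp add: velocity_def)
  moreover have "w (A k j) = 0" if "k \<in> {2..\<mu>}" "j \<in> {1..<n}" for k j
    using triv(2)[of j "k - 1"] that mu by (auto simp: velocity_def)
  ultimately have "w u = 0" if "u \<in> set ?dv" for u
    using that by (auto simp: set_deflated_vars)
  then have "v $ c = 0" if "c < \<mu> * n" for c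
    using w_nth[OF that] bij that by (metis bij_betwE lessThan_iff)
  then show "v = 0\<^sub>v (\<mu> * n)" using v by (intro eq_vecI) auto
qed

end

section \<open>The primary component at the root\<close>

lemma xring_simps [simp]:
  "carrier (xring n) = {p. indets p \<subseteq> X ` {..<n}}"
  "p \<otimes>\<^bsub>xring n\<^esub> q = p * q" "\<one>\<^bsub>xring n\<^esub> = 1" "\<zero>\<^bsub>xring n\<^esub> = 0" "p \<oplus>\<^bsub>xring n\<^esub> q = p + q"
  by (simp_all add: xring_def mpoly_ring_def)

lemma xring_closed:
  fixes p q :: "'a::comm_ring_1 pvpoly"
  shows "indets p \<subseteq> V \<Longrightarrow> indets q \<subseteq> V \<Longrightarrow> indets (p + q) \<subseteq> V"
    and "indets p \<subseteq> V \<Longrightarrow> indets q \<subseteq> V \<Longrightarrow> indets (p * q) \<subseteq> V"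
    and "indets p \<subseteq> V \<Longrightarrow> indets q \<subseteq> V \<Longrightarrow> indets (p - q) \<subseteq> V"
  using indets_add[of p q] indets_mult[of p q] indets_diff[of p q] by blast+

lemma cring_xring: "cring (xring n :: 'a::comm_ring_1 pvpoly ring)"
proof (rule cringI)
  show "abelian_group (xring n :: 'a pvpoly ring)"
  proof (rule abelian_groupI)
    fix p :: "'a pvpoly" assume "p \<in> carrier (xring n)"
    then show "\<exists>q\<in>carrier (xring n). q \<oplus>\<^bsub>xring n\<^esub> p = \<zero>\<^bsub>xring n\<^esub>"
      by (intro bexI[of _ "- p"]) simp_all
  qed (simp_all add: xring_closed algebra_simps)
  show "Group.comm_monoid (xring n :: 'a pvpoly ring)"
    by (rule comm_monoidI) (simp_all add: xring_closed algebra_simps)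
qed (simp_all add: algebra_simps)

lemma xring_uminus:
  fixes p :: "'a::comm_ring_1 pvpoly"
  assumes "p \<in> carrier (xring n)"
  shows "\<ominus>\<^bsub>xring n\<^esub> p = - p"
proof -
  interpret R: cring "xring n :: 'a pvpoly ring" by (rule cring_xring)
  show ?thesis by (rule R.minus_equality) (use assms in simp_all)
qed

lemma xring_pow: "p [^]\<^bsub>xring n\<^esub> (k::nat) = p ^ k" for p :: "'a::comm_ring_1 pvpoly"
  by (induction k) (simp_all add: nat_pow_def mult.commute)

lemma ideal_xring_iff:
  fixes Q :: "'a::comm_ring_1 pvpoly set"
  shows "ideal Q (xring n) \<longleftrightarrow> Q \<subseteq> carrier (xring n) \<and> 0 \<in> Q \<and> (\<forall>p\<in>Q. \<forall>q\<in>Q. p + q \<in> Q) \<and>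
    (\<forall>p\<in>Q. \<forall>r\<in>carrier (xring n). r * p \<in> Q)"
proof
  assume "ideal Q (xring n)"
  then interpret ideal Q "xring n :: 'a pvpoly ring" .
  show "Q \<subseteq> carrier (xring n) \<and> 0 \<in> Q \<and> (\<forall>p\<in>Q. \<forall>q\<in>Q. p + q \<in> Q) \<and>
    (\<forall>p\<in>Q. \<forall>r\<in>carrier (xring n). r * p \<in> Q)"
    using a_subset additive_subgroup.a_closed[OF additive_subgroup_axioms] I_l_closed additive_subgroup.zero_closed[OF additive_subgroup_axioms] by auto
next
  interpret R: cring "xring n :: 'a pvpoly ring" by (rule cring_xring)
  assume *: "Q \<subseteq> carrier (xring n) \<and> 0 \<in> Q \<and> (\<forall>p\<in>Q. \<forall>q\<in>Q. p + q \<in> Q) \<and>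
    (\<forall>p\<in>Q. \<forall>r\<in>carrier (xring n). r * p \<in> Q)"
  have minus: "- p \<in> Q" if "p \<in> Q" for p
  proof -
    have "\<forall>r. indets r \<subseteq> X ` {..<n} \<longrightarrow> r * p \<in> Q" using * that by simp
    from spec[OF this, of "- 1"] show ?thesis by simp
  qed
  show "ideal Q (xring n)"
  proof (rule idealI)
    show "subgroup Q (add_monoid (xring n))"
    proof (rule R.add.subgroupI)
      fix p assume "p \<in> Q"
      then show "\<ominus>\<^bsub>xring n\<^esub> p \<in> Q"
        using minus xring_uminus[of p n] * by auto
    qed (use * in auto)
  qed (use * R.ring_axioms in \<open>auto simp: mult.commute\<close>)
qed

text \<open>Modulo the generators every polynomial is congruent to its value at the point.\<close>

lemma point_ideal_eq:
  fixes x :: "'a::comm_ring_1 vec"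
  shows "point_ideal n x = {p \<in> carrier (xring n). meval (xpoint x) p = 0}"
proof
  interpret R: cring "xring n :: 'a pvpoly ring" by (rule cring_xring)
  interpret ev: comm_ring_hom "meval (xpoint x)" by (rule comm_ring_hom_meval)
  let ?G = "{mVar (X i) - mConst (x $ i) | i. i < n} :: 'a pvpoly set"
  have G: "?G \<subseteq> carrier (xring n)"
    using xring_closed(3)[of "mVar (X _)" "X ` {..<n}" "mConst _"] by auto
  have "ideal {p \<in> carrier (xring n). meval (xpoint x) p = 0} (xring n)"
    by (simp add: ideal_xring_iff ev.hom_add ev.hom_mult xring_closed Collect_mono_iff)
  then show "point_ideal n x \<subseteq> {p \<in> carrier (xring n). meval (xpoint x) p = 0}"
    unfolding point_ideal_def using G
    by (intro R.genideal_minimal) (auto simp: ev.hom_minus meval_mVar meval_mConst)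
  have "ideal (point_ideal n x) (xring n)"
    unfolding point_ideal_def using G by (rule R.genideal_ideal)
  then have P: "0 \<in> point_ideal n x" "\<And>p q. p \<in> point_ideal n x \<Longrightarrow> q \<in> point_ideal n x \<Longrightarrow> p + q \<in> point_ideal n x"
    "\<And>p r. p \<in> point_ideal n x \<Longrightarrow> indets r \<subseteq> X ` {..<n} \<Longrightarrow> r * p \<in> point_ideal n x"
    unfolding ideal_xring_iff by auto
  have gen: "?G \<subseteq> point_ideal n x"
    unfolding point_ideal_def using G by (rule R.genideal_self)
  have "p - mConst (meval (xpoint x) p) \<in> point_ideal n x" if "indets p \<subseteq> X ` {..<n}" for p
    using that
  proof (induction p rule: mpoly_induct)
    case (const c)
    then show ?case using P(1) by (simp add: meval_mVar meval_mConst)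
  next
    case (var v)
    then show ?case using gen by (auto simp: meval_mVar meval_mConst)
  next
    case (add p q)
    have "p + q - mConst (meval (xpoint x) (p + q))
        = (p - mConst (meval (xpoint x) p)) + (q - mConst (meval (xpoint x) q))"
      by (simp add: ev.hom_add mConst_def single_add)
    then show ?case using add P(2) by metis
  next
    case (mult p q)
    have "p * q - mConst (meval (xpoint x) (p * q))
        = p * (q - mConst (meval (xpoint x) q)) + mConst (meval (xpoint x) q) * (p - mConst (meval (xpoint x) p))"
      by (simp add: ev.hom_mult mConst_def mult_single algebra_simps)
    then show ?case using mult P by (metis empty_subsetI indets_mConst)
  qed
  then show "{p \<in> carrier (xring n). meval (xpoint x) p = 0} \<subseteq> point_ideal n x"
    by (force simp: mConst_def)
qed

locale point_component =
  fixes n :: nat and F :: "'a::field_char_0 pvpoly vec" and x :: "'a vec" and Q :: "'a pvpoly set"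
  assumes n: "n \<ge> 1" and F: "\<And>i. i < n \<Longrightarrow> indets (F $ i) \<subseteq> X ` {..<n}"
    and component: "isolated_primary_component (xring n) (system_ideal n F) (point_ideal n x) Q"
begin

abbreviation ev where "ev \<equiv> meval (xpoint x)"

sublocale ev: comm_ring_hom ev by (rule comm_ring_hom_meval)
sublocale R: cring "xring n :: 'a pvpoly ring" by (rule cring_xring)

lemma primary: "primary_ideal (xring n) Q" and radical_Q: "Defs.radical (xring n) Q = point_ideal n x"
  using component by (auto simp: isolated_primary_component_def primary_decomposition_def)

lemma ideal_Q: "ideal Q (xring n)"
  using primary by (simp add: primary_ideal_def)

lemma Q_carrier: "p \<in> Q \<Longrightarrow> indets p \<subseteq> X ` {..<n}"
  and Q_zero: "0 \<in> Q"
  and Q_add: "p \<in> Q \<Longrightarrow> q \<in> Q \<Longrightarrow> p + q \<in> Q"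
  and Q_mult: "p \<in> Q \<Longrightarrow> indets r \<subseteq> X ` {..<n} \<Longrightarrow> r * p \<in> Q"
  using ideal_Q unfolding ideal_xring_iff by auto

lemma Q_diff: "p \<in> Q \<Longrightarrow> q \<in> Q \<Longrightarrow> p - q \<in> Q"
  using Q_add[of p "- 1 * q"] Q_mult[of q "- 1"] by simp

lemma Q_sum: "(\<And>i. i \<in> I \<Longrightarrow> f i \<in> Q) \<Longrightarrow> sum f I \<in> Q"
  by (induction I rule: infinite_finite_induct) (auto simp: Q_zero Q_add)

lemma power_in_Q:
  assumes "indets p \<subseteq> X ` {..<n}" "ev p = 0"
  obtains k where "p ^ k \<in> Q"
proof -
  have "p \<in> Defs.radical (xring n) Q"
    using assms by (simp add: radical_Q point_ideal_eq)
  then show thesis using that by (auto simp: Defs.radical_def xring_pow)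
qed

lemma Q_vanishes: "p \<in> Q \<Longrightarrow> ev p = 0"
proof -
  assume "p \<in> Q"
  then have "p \<in> Defs.radical (xring n) Q"
    using Q_carrier by (auto simp: Defs.radical_def xring_pow intro!: exI[of _ "1::nat"])
  then show ?thesis by (simp add: radical_Q point_ideal_eq)
qed

text \<open>The component is primary, and its radical consists of the polynomials vanishing at the point.\<close>

lemma Q_cancel:
  assumes "p * q \<in> Q" "indets p \<subseteq> X ` {..<n}" "indets q \<subseteq> X ` {..<n}" "ev q \<noteq> 0"
  shows "p \<in> Q"
proof -
  have "q \<notin> Defs.radical (xring n) Q" using assms(4) by (simp add: radical_Q point_ideal_eq)
  then show ?thesis using primary assms(1-3) unfolding primary_ideal_def by auto
qed

lemma F_in_Q: "i < n \<Longrightarrow> F $ i \<in> Q"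
proof -
  assume i: "i < n"
  obtain D where "carrier (xring n) \<inter> \<Inter>D = system_ideal n F" "Q \<in> D"
    using component unfolding isolated_primary_component_def primary_decomposition_def by blast
  moreover have "F $ i \<in> system_ideal n F"
    unfolding system_ideal_def by (rule subsetD[OF R.genideal_self]) (use F i in auto)
  ultimately show ?thesis by blast
qed

text \<open>The component consists of polynomials that enter the ideal after multiplication by some \<open>s\<close> with
  nonzero value at the point. As the associated prime of \<open>Q\<close> is isolated and the associated primes
  are distinct, the radical of each of the other components contains a polynomial that is nonzero
  at the point; \<open>s\<close> is the product of suitable powers of these.\<close>

lemma component_local:
  assumes "p \<in> Q"
  obtains s where "indets s \<subseteq> X ` {..<n}" "ev s \<noteq> 0" "s * p \<in> system_ideal n F"
proof -
  obtain D where D: "finite D" "\<forall>Q\<in>D. primary_ideal (xring n) Q" "carrier (xring n) \<inter> \<Inter>D = system_ideal n F"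
    "inj_on (Defs.radical (xring n)) D" "Q \<in> D" "\<forall>Q'\<in>D. \<not> Defs.radical (xring n) Q' \<subset> point_ideal n x"
    using component unfolding isolated_primary_component_def primary_decomposition_def by blast
  have "\<exists>g. g \<in> Q' \<and> indets g \<subseteq> X ` {..<n} \<and> ev g \<noteq> 0" if "Q' \<in> D - {Q}" for Q'
  proof -
    have "Defs.radical (xring n) Q' \<noteq> Defs.radical (xring n) Q"
      using D(4,5) that by (auto simp: inj_on_def)
    then have "\<not> Defs.radical (xring n) Q' \<subseteq> point_ideal n x"
      using D(6) that radical_Q by blast
    then obtain r k where "indets r \<subseteq> X ` {..<n}" "r ^ k \<in> Q'" "ev r \<noteq> 0"
      by (auto simp: Defs.radical_def point_ideal_eq xring_pow)
    then show ?thesis by (intro exI[of _ "r ^ k"]) (simp add: ev.hom_power indets_power)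
  qed
  then obtain g where g: "\<And>Q'. Q' \<in> D - {Q} \<Longrightarrow> g Q' \<in> Q' \<and> indets (g Q') \<subseteq> X ` {..<n} \<and> ev (g Q') \<noteq> 0"
    by metis
  define s where "s = (\<Prod>Q'\<in>D - {Q}. g Q')"
  have s: "indets s \<subseteq> X ` {..<n}" unfolding s_def by (rule indets_prod) (use g in auto)
  have "s * p \<in> Q'" if "Q' \<in> D" for Q'
  proof (cases "Q' = Q")
    case True
    then show ?thesis using assms Q_mult s by simp
  next
    case False
    have idl: "ideal Q' (xring n)" using D(2) that by (simp add: primary_ideal_def)
    define t where "t = (\<Prod>Q''\<in>D - {Q} - {Q'}. g Q'')"
    have "s = g Q' * t" unfolding s_def t_def using False that D(1) by (intro prod.remove) auto
    then have sp: "s * p = (t * p) * g Q'" by (simp add: ac_simps)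
    have "indets t \<subseteq> X ` {..<n}" unfolding t_def by (rule indets_prod) (use g in auto)
    then have "indets (t * p) \<subseteq> X ` {..<n}" using assms Q_carrier by (intro xring_closed)
    moreover have "g Q' \<in> Q'" using g False that by blast
    ultimately show ?thesis using idl unfolding ideal_xring_iff sp by simp
  qed
  moreover have "s * p \<in> carrier (xring n)" using s assms Q_carrier by (simp add: xring_closed)
  ultimately have "s * p \<in> system_ideal n F" using D(3) by blast
  moreover have "ev s \<noteq> 0" using g D(1) by (simp add: s_def ev.hom_prod)
  ultimately show thesis using s that by blast
qed

end

section \<open>Reducing modulo the primary component to one variable\<close>

lemma pull_poly_mVar: "pull_poly \<xi> (mVar v) = coords \<xi> v"
  and pull_poly_mConst: "pull_poly \<xi> (mConst c) = [:c:]"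
  by (simp_all add: pull_poly_def comm_ring_hom.mpoly_subst_mVar[OF comm_ring_hom_const_poly]
      comm_ring_hom.mpoly_subst_mConst[OF comm_ring_hom_const_poly])

lemma indets_det:
  fixes M :: "'a::comm_ring_1 pvpoly mat"
  assumes "M \<in> carrier_mat m m" "\<And>i j. i < m \<Longrightarrow> j < m \<Longrightarrow> indets (M $$ (i, j)) \<subseteq> V"
  shows "indets (det M) \<subseteq> V"
proof -
  have sign: "indets (signof p :: 'a pvpoly) \<subseteq> V" for p :: "nat \<Rightarrow> nat"
    by (simp add: sign_def)
  show ?thesis
    unfolding det_def'[OF assms(1)]
  proof (intro indets_sum xring_closed(2) sign indets_prod)
    fix p i assume "p \<in> {p. p permutes {0..<m}}" "i \<in> {0..<m}"
    then show "indets (M $$ (i, p i)) \<subseteq> V"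
      using assms(2)[of i "p i"] permutes_in_image[of p "{0..<m}" i] by auto
  qed
qed

lemma indets_adj_mat:
  fixes M :: "'a::comm_ring_1 pvpoly mat"
  assumes M: "M \<in> carrier_mat m m" "\<And>i j. i < m \<Longrightarrow> j < m \<Longrightarrow> indets (M $$ (i, j)) \<subseteq> V"
    and ij: "i < m" "j < m"
  shows "indets (adj_mat M $$ (i, j)) \<subseteq> V"
proof -
  have "indets (det (mat_delete M j i)) \<subseteq> V"
  proof (rule indets_det)
    show "mat_delete M j i \<in> carrier_mat (m - 1) (m - 1)" using M(1) by (rule mat_delete_carrier)
    fix k l assume "k < m - 1" "l < m - 1"
    then show "indets (mat_delete M j i $$ (k, l)) \<subseteq> V"
      using M ij by (simp add: mat_delete_def)
  qed
  moreover have "indets ((- 1) ^ (j + i) :: 'a pvpoly) \<subseteq> V" by (rule indets_power) simp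
  ultimately have "indets (cofactor M j i) \<subseteq> V" unfolding cofactor_def by (intro xring_closed)
  then show ?thesis using M(1) ij by (simp add: adj_mat_def)
qed

text \<open>The condition on the determinant says that the lower equations can be solved for the last
  coordinates; then everything modulo \<open>Q\<close> is a polynomial in the local coordinate \<open>\<tau>\<close>.\<close>

locale regular_point_component = point_component +
  assumes det: "det (lin_block n F x) \<noteq> 0"
begin

definition \<tau> :: "'a pvpoly" where "\<tau> = mVar (X 0) - mConst (x $ 0)"

lemma indets_\<tau>: "indets \<tau> \<subseteq> X ` {..<n}"
  unfolding \<tau>_def by (rule xring_closed) (use n in auto)

lemma ev_\<tau>: "ev \<tau> = 0"
  by (simp add: \<tau>_def ev.hom_minus meval_mVar meval_mConst)

definition at_\<tau> :: "'a poly \<Rightarrow> 'a pvpoly" where "at_\<tau> q = poly (map_poly mConst q) \<tau>"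

sublocale mc: comm_ring_hom "mConst :: 'a \<Rightarrow> 'a pvpoly" by (rule comm_ring_hom_mConst)

lemma at_\<tau>_0 [simp]: "at_\<tau> 0 = 0"
  by (simp add: at_\<tau>_def)

lemma at_\<tau>_pCons: "at_\<tau> (pCons c q) = mConst c + \<tau> * at_\<tau> q"
  by (cases "c = 0 \<and> q = 0") (auto simp: at_\<tau>_def map_poly_pCons)

sublocale at: comm_ring_hom at_\<tau>
proof -
  have add: "at_\<tau> (p + q) = at_\<tau> p + at_\<tau> q" for p q
    by (induction p q rule: poly_induct2) (simp_all add: at_\<tau>_pCons mc.hom_add algebra_simps)
  have smult: "at_\<tau> (smult c p) = mConst c * at_\<tau> p" for c p
    by (induction p) (simp_all add: at_\<tau>_pCons mc.hom_mult algebra_simps)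
  have mult: "at_\<tau> (p * q) = at_\<tau> p * at_\<tau> q" for p q
    by (induction p) (simp_all add: at_\<tau>_pCons add smult algebra_simps)
  show "comm_ring_hom at_\<tau>"
    by unfold_locales (simp_all add: add mult, simp add: at_\<tau>_def)
qed

lemma at_\<tau>_const: "at_\<tau> [:c:] = mConst c"
  by (simp add: at_\<tau>_pCons)

lemma at_\<tau>_monom: "at_\<tau> (monom c k) = mConst c * \<tau> ^ k"
  by (induction k) (simp_all add: monom_0 monom_Suc at_\<tau>_pCons ac_simps)

lemma indets_at_\<tau>: "indets (at_\<tau> q) \<subseteq> X ` {..<n}"
proof (induction q)
  case (pCons c q)
  show ?case unfolding at_\<tau>_pCons by (intro xring_closed indets_\<tau> pCons.IH) simp
qed simp

lemma ev_at_\<tau>: "ev (at_\<tau> q) = coeff q 0"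
  by (cases q) (simp add: at_\<tau>_pCons ev.hom_add ev.hom_mult ev_\<tau> meval_mConst)

text \<open>The nilpotency index of \<open>\<tau>\<close> modulo \<open>Q\<close>. It will turn out to be the multiplicity.\<close>

definition nil_index where "nil_index = (LEAST k. \<tau> ^ k \<in> Q)"

lemma \<tau>_power_nil_index_in_Q: "\<tau> ^ nil_index \<in> Q"
proof -
  obtain k where "\<tau> ^ k \<in> Q" using power_in_Q[OF indets_\<tau> ev_\<tau>] .
  then show ?thesis unfolding nil_index_def by (rule LeastI)
qed

lemma \<tau>_power_notin_Q: "k < nil_index \<Longrightarrow> \<tau> ^ k \<notin> Q"
  unfolding nil_index_def by (rule not_less_Least)

lemma nil_index_pos: "nil_index \<ge> 1"
proof (rule ccontr)
  assume "\<not> nil_index \<ge> 1"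
  then have "nil_index = 0" by simp
  then have "1 \<in> Q" using \<tau>_power_nil_index_in_Q by simp
  then show False using Q_vanishes[of 1] by simp
qed

text \<open>If a coefficient below the nilpotency index were nonzero, the polynomial would be a smaller
  power of \<open>\<tau>\<close> times a factor that is nonzero at the point and can be cancelled.\<close>

lemma at_\<tau>_in_Q_iff: "at_\<tau> q \<in> Q \<longleftrightarrow> (\<forall>k<nil_index. coeff q k = 0)"
proof
  assume q: "at_\<tau> q \<in> Q"
  show "\<forall>k<nil_index. coeff q k = 0"
  proof (rule ccontr)
    assume "\<not> (\<forall>k<nil_index. coeff q k = 0)"
    then obtain d' where d': "coeff q d' \<noteq> 0" "d' < nil_index" by blast
    define d where "d = (LEAST d. coeff q d \<noteq> 0)"
    have d: "coeff q d \<noteq> 0" "d < nil_index" "\<And>k. k < d \<Longrightarrow> coeff q k = 0"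
    proof -
      show "coeff q d \<noteq> 0" unfolding d_def by (rule LeastI[of "\<lambda>d. coeff q d \<noteq> 0", OF d'(1)])
      show "d < nil_index"
        using Least_le[of "\<lambda>d. coeff q d \<noteq> 0", OF d'(1)] d'(2) unfolding d_def by simp
      show "coeff q k = 0" if "k < d" for k
        using not_less_Least[of k "\<lambda>d. coeff q d \<noteq> 0"] that unfolding d_def by blast
    qed
    then have "monom 1 d dvd q" by (simp add: monom_1_dvd_iff')
    then obtain u where u: "q = monom 1 d * u" by (elim dvdE)
    then have "coeff u 0 \<noteq> 0" using d(1) by (simp add: coeff_monom_mult)
    moreover have "\<tau> ^ d * at_\<tau> u \<in> Q" using q by (simp add: u at.hom_mult at_\<tau>_monom)
    ultimately have "\<tau> ^ d \<in> Q"
      by (intro Q_cancel[of "\<tau> ^ d" "at_\<tau> u"] indets_power indets_\<tau> indets_at_\<tau>) (simp_all add: ev_at_\<tau>)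
    then show False using \<tau>_power_notin_Q[OF d(2)] by simp
  qed
next
  assume "\<forall>k<nil_index. coeff q k = 0"
  then obtain u where "q = monom 1 nil_index * u" by (metis monom_1_dvd_iff' dvdE)
  then have "at_\<tau> q = at_\<tau> u * \<tau> ^ nil_index" by (simp add: at.hom_mult at_\<tau>_monom mult.commute)
  then show "at_\<tau> q \<in> Q" using Q_mult[OF \<tau>_power_nil_index_in_Q indets_at_\<tau>] by simp
qed

text \<open>A Hadamard-type expansion: replacing each coordinate by the arc at \<open>\<tau>\<close> changes \<open>p\<close> by a
  combination of the differences of the coordinates, and the values of the coefficients at the point
  are the partial derivatives of \<open>p\<close>.\<close>

lemma arc_expansion:
  assumes first: "\<xi> 0 = [:x $ 0, 1:]" and base: "\<And>j. j < n \<Longrightarrow> coeff (\<xi> j) 0 = x $ j"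
    and p: "indets p \<subseteq> X ` {..<n}"
  shows "\<exists>C. p - at_\<tau> (pull_poly \<xi> p) = (\<Sum>j\<in>{1..<n}. C j * (mVar (X j) - at_\<tau> (\<xi> j)))
    \<and> (\<forall>j\<in>{1..<n}. indets (C j) \<subseteq> X ` {..<n} \<and> ev (C j) = ev (mderiv (X j) p))"
  using p
proof (induction p rule: mpoly_induct)
  case (const c)
  show ?case
    by (intro exI[of _ "\<lambda>_. 0"])
       (simp add: pull_poly_mConst at_\<tau>_const)
next
  case (var v)
  then obtain m where m: "v = X m" "m < n" by auto
  have pull: "pull_poly \<xi> (mVar (X m)) = \<xi> m" by (simp add: pull_poly_mVar)
  show ?case
  proof (cases "m = 0")
    case True
    then have "mVar v - at_\<tau> (pull_poly \<xi> (mVar v)) = 0"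
      using pull by (simp add: m first at_\<tau>_pCons \<tau>_def)
    then show ?thesis using True m by (intro exI[of _ "\<lambda>_. 0"]) (simp add: mderiv_mVar)
  next
    case False
    have "(\<Sum>j\<in>{1..<n}. (if j = m then 1 else 0) * (mVar (X j) - at_\<tau> (\<xi> j))) = mVar v - at_\<tau> (\<xi> m)"
      using False m by (simp add: if_distrib[of "\<lambda>a. a * _"] cong: if_cong)
    then show ?thesis
      using m by (intro exI[of _ "\<lambda>j. if j = m then 1 else 0"]) (auto simp: pull mderiv_mVar)
  qed
next
  case (add p q)
  interpret pull: comm_ring_hom "pull_poly \<xi>" by (rule comm_ring_hom_pull_poly)
  obtain C D where C: "p - at_\<tau> (pull_poly \<xi> p) = (\<Sum>j\<in>{1..<n}. C j * (mVar (X j) - at_\<tau> (\<xi> j)))"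
    "\<forall>j\<in>{1..<n}. indets (C j) \<subseteq> X ` {..<n} \<and> ev (C j) = ev (mderiv (X j) p)"
    and D: "q - at_\<tau> (pull_poly \<xi> q) = (\<Sum>j\<in>{1..<n}. D j * (mVar (X j) - at_\<tau> (\<xi> j)))"
    "\<forall>j\<in>{1..<n}. indets (D j) \<subseteq> X ` {..<n} \<and> ev (D j) = ev (mderiv (X j) q)"
    using add.IH by blast
  have "p + q - at_\<tau> (pull_poly \<xi> (p + q))
      = (p - at_\<tau> (pull_poly \<xi> p)) + (q - at_\<tau> (pull_poly \<xi> q))"
    by (simp add: pull.hom_add at.hom_add)
  also have "\<dots> = (\<Sum>j\<in>{1..<n}. (C j + D j) * (mVar (X j) - at_\<tau> (\<xi> j)))"
    unfolding C(1) D(1) by (simp only: sum.distrib distrib_right)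
  finally show ?case
    using C(2) D(2)
    by (intro exI[of _ "\<lambda>j. C j + D j"]) (simp add: mderiv_add ev.hom_add xring_closed)
next
  case (mult p q)
  interpret pull: comm_ring_hom "pull_poly \<xi>" by (rule comm_ring_hom_pull_poly)
  obtain C D where C: "p - at_\<tau> (pull_poly \<xi> p) = (\<Sum>j\<in>{1..<n}. C j * (mVar (X j) - at_\<tau> (\<xi> j)))"
    "\<forall>j\<in>{1..<n}. indets (C j) \<subseteq> X ` {..<n} \<and> ev (C j) = ev (mderiv (X j) p)"
    and D: "q - at_\<tau> (pull_poly \<xi> q) = (\<Sum>j\<in>{1..<n}. D j * (mVar (X j) - at_\<tau> (\<xi> j)))"
    "\<forall>j\<in>{1..<n}. indets (D j) \<subseteq> X ` {..<n} \<and> ev (D j) = ev (mderiv (X j) q)"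
    using mult.IH by blast
  let ?p = "at_\<tau> (pull_poly \<xi> p)"
  have "ev ?p = ev p"
    using pull_nth_0[OF mult.hyps(1), of "\<lambda>j. fps_of_poly (\<xi> j)" x] base
    by (simp add: ev_at_\<tau> pull_fps_of_poly)
  moreover have "p * q - at_\<tau> (pull_poly \<xi> (p * q))
      = q * (p - ?p) + ?p * (q - at_\<tau> (pull_poly \<xi> q))"
    by (simp add: pull.hom_mult at.hom_mult algebra_simps)
  moreover have "\<dots> = (\<Sum>j\<in>{1..<n}. (q * C j + ?p * D j) * (mVar (X j) - at_\<tau> (\<xi> j)))"
    unfolding C(1) D(1) by (simp only: sum_distrib_left sum.distrib distrib_right mult.assoc)
  ultimately show ?case
    using C(2) D(2) mult.hyps indets_at_\<tau>
    by (intro exI[of _ "\<lambda>j. q * C j + ?p * D j"])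
       (simp add: xring_closed ev.hom_add ev.hom_mult mderiv_mult mult.commute)
qed

text \<open>The expansions of the lower equations form a linear system, with right hand sides in \<open>Q\<close>,
  for the differences \<open>y j\<close> between coordinates and arc. Its determinant is nonzero at the point,
  so by Cramer's rule and cancellation the differences lie in \<open>Q\<close>.\<close>

lemma arc_residue_in_Q:
  assumes first: "\<xi> 0 = [:x $ 0, 1:]" and base: "\<And>j. j < n \<Longrightarrow> coeff (\<xi> j) 0 = x $ j"
    and lower: "\<And>i k. i \<in> {1..<n} \<Longrightarrow> k < nil_index \<Longrightarrow> coeff (pull_poly \<xi> (F $ i)) k = 0"
    and p: "indets p \<subseteq> X ` {..<n}"
  shows "p - at_\<tau> (pull_poly \<xi> p) \<in> Q"
proof -
  define y where "y j = mVar (X j) - at_\<tau> (\<xi> j)" for j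
  have ind_y: "indets (y j) \<subseteq> X ` {..<n}" if "j < n" for j
    unfolding y_def by (rule xring_closed) (use that indets_at_\<tau> in auto)
  have "\<forall>i\<in>{..<n}. \<exists>C. F $ i - at_\<tau> (pull_poly \<xi> (F $ i)) = (\<Sum>j\<in>{1..<n}. C j * y j)
      \<and> (\<forall>j\<in>{1..<n}. indets (C j) \<subseteq> X ` {..<n} \<and> ev (C j) = ev (mderiv (X j) (F $ i)))"
  proof
    fix i assume "i \<in> {..<n}"
    then have "indets (F $ i) \<subseteq> X ` {..<n}" using F by simp
    then show "\<exists>C. F $ i - at_\<tau> (pull_poly \<xi> (F $ i)) = (\<Sum>j\<in>{1..<n}. C j * y j)
      \<and> (\<forall>j\<in>{1..<n}. indets (C j) \<subseteq> X ` {..<n} \<and> ev (C j) = ev (mderiv (X j) (F $ i)))"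
      unfolding y_def by (intro arc_expansion first base)
  qed
  from bchoice[OF this] obtain C where
    C: "\<And>i. i < n \<Longrightarrow> F $ i - at_\<tau> (pull_poly \<xi> (F $ i)) = (\<Sum>j\<in>{1..<n}. C i j * y j)"
    and C': "\<And>i j. i < n \<Longrightarrow> j \<in> {1..<n} \<Longrightarrow> indets (C i j) \<subseteq> X ` {..<n} \<and> ev (C i j) = ev (mderiv (X j) (F $ i))"
    by blast
  have sys: "(\<Sum>j\<in>{1..<n}. C i j * y j) \<in> Q" if "i \<in> {1..<n}" for i
  proof -
    have "at_\<tau> (pull_poly \<xi> (F $ i)) \<in> Q" using lower[OF that] by (simp add: at_\<tau>_in_Q_iff)
    then show ?thesis using C[of i, symmetric] Q_diff[OF F_in_Q[of i]] that by simp
  qed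
  let ?B = "lower_block n C"
  have B: "?B \<in> carrier_mat (n - 1) (n - 1)" by (rule lower_block_carrier)
  have entries: "indets (?B $$ (i, j)) \<subseteq> X ` {..<n}" if "i < n - 1" "j < n - 1" for i j
    using that C'[of "Suc i" "Suc j"] by (simp add: lower_block_def)
  have "map_mat ev ?B = lin_block n F x"
    unfolding lin_block_def lower_block_def
    by (rule eq_matI) (use C' in auto)
  then have det_B: "ev (det ?B) \<noteq> 0" using det by (metis ev.hom_det)
  have y_in_Q: "y j \<in> Q" if j: "j \<in> {1..<n}" for j
  proof (rule Q_cancel[OF _ _ indets_det[OF B entries] det_B])
    have "(\<Sum>i\<in>{1..<n}. adj_mat ?B $$ (j - 1, i - 1) * (\<Sum>k\<in>{1..<n}. C i k * y k)) \<in> Q"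
    proof (rule Q_sum)
      fix i assume i: "i \<in> {1..<n}"
      have "indets (adj_mat ?B $$ (j - 1, i - 1)) \<subseteq> X ` {..<n}"
        by (rule indets_adj_mat[OF B entries]) (use i j in auto)
      then show "adj_mat ?B $$ (j - 1, i - 1) * (\<Sum>k\<in>{1..<n}. C i k * y k) \<in> Q"
        by (intro Q_mult sys i)
    qed
    then show "y j * det ?B \<in> Q"
      unfolding lower_block_left_inverse[OF j] by (subst mult.commute)
    show "indets (y j) \<subseteq> X ` {..<n}" using ind_y j by simp
  qed auto
  obtain D where D: "p - at_\<tau> (pull_poly \<xi> p) = (\<Sum>j\<in>{1..<n}. D j * y j)"
    "\<forall>j\<in>{1..<n}. indets (D j) \<subseteq> X ` {..<n} \<and> ev (D j) = ev (mderiv (X j) p)"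
    unfolding y_def using arc_expansion[where \<xi> = \<xi>, OF first base p] by blast
  show ?thesis unfolding D(1) by (rule Q_sum) (use D(2) y_in_Q Q_mult in auto)
qed

text \<open>Along the arc, $f_1$ cannot vanish to an order below the nilpotency index, since it lies in
  \<open>Q\<close>. It cannot vanish to a higher order either: then so would the whole ideal, hence also
  $s \tau^{d}$ for some $s$ that is nonzero at the point, where $d$ is the nilpotency index.\<close>

theorem exists_arc_of_order_nil_index:
  obtains \<xi> where "\<xi> 0 = [:x $ 0, 1:]" "\<And>j. j < n \<Longrightarrow> coeff (\<xi> j) 0 = x $ j"
    "\<And>i k. i \<in> {1..<n} \<Longrightarrow> k \<le> nil_index \<Longrightarrow> coeff (pull_poly \<xi> (F $ i)) k = 0"
    "\<And>k. k < nil_index \<Longrightarrow> coeff (pull_poly \<xi> (F $ 0)) k = 0"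
    "coeff (pull_poly \<xi> (F $ 0)) nil_index \<noteq> 0"
    "\<And>p. indets p \<subseteq> X ` {..<n} \<Longrightarrow> p - at_\<tau> (pull_poly \<xi> p) \<in> Q"
proof -
  have root: "ev (F $ i) = 0" if "i < n" for i using Q_vanishes F_in_Q that by simp
  obtain \<xi> where first: "\<xi> 0 = [:x $ 0, 1:]" and base: "\<And>j. j < n \<Longrightarrow> coeff (\<xi> j) 0 = x $ j"
    and lower: "\<And>i k. i \<in> {1..<n} \<Longrightarrow> k < Suc nil_index \<Longrightarrow> coeff (pull_poly \<xi> (F $ i)) k = 0"
    \<comment> \<open>One order more than the nilpotency index, so that the exact order of $f_1$ is visible.\<close>
    using exists_approximate_arc[OF n F root det, of "Suc nil_index"] by blast
  interpret pull: comm_ring_hom "pull_poly \<xi>" by (rule comm_ring_hom_pull_poly)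
  have residue: "p - at_\<tau> (pull_poly \<xi> p) \<in> Q" if "indets p \<subseteq> X ` {..<n}" for p
    using arc_residue_in_Q[OF first base _ that] lower by simp
  have "at_\<tau> (pull_poly \<xi> (F $ 0)) \<in> Q"
    using Q_diff[OF F_in_Q residue[OF F], of 0 0] n by simp
  then have low: "coeff (pull_poly \<xi> (F $ 0)) k = 0" if "k < nil_index" for k
    using that by (simp add: at_\<tau>_in_Q_iff)
  have "coeff (pull_poly \<xi> (F $ 0)) nil_index \<noteq> 0"
  proof
    assume zero: "coeff (pull_poly \<xi> (F $ 0)) nil_index = 0"
    have "monom 1 (Suc nil_index) dvd pull_poly \<xi> (F $ i)" if "i < n" for i
      using lower[of i] low zero that by (cases "i = 0") (auto simp: monom_1_dvd_iff' less_Suc_eq)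
    moreover have "ideal {p \<in> carrier (xring n). monom 1 (Suc nil_index) dvd pull_poly \<xi> p} (xring n)"
      by (simp add: ideal_xring_iff pull.hom_add pull.hom_mult xring_closed Collect_mono_iff)
    ultimately have sub: "system_ideal n F \<subseteq> {p \<in> carrier (xring n). monom 1 (Suc nil_index) dvd pull_poly \<xi> p}"
      unfolding system_ideal_def using F by (intro R.genideal_minimal) auto
    obtain s where s: "indets s \<subseteq> X ` {..<n}" "ev s \<noteq> 0" "s * \<tau> ^ nil_index \<in> system_ideal n F"
      using component_local[OF \<tau>_power_nil_index_in_Q] .
    have "pull_poly \<xi> \<tau> = monom 1 1"
      by (simp add: \<tau>_def pull.hom_minus pull_poly_mVar pull_poly_mConst first monom_altdef)
    then have "pull_poly \<xi> (s * \<tau> ^ nil_index) = monom 1 nil_index * pull_poly \<xi> s"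
      by (simp add: pull.hom_mult pull.hom_power monom_power mult.commute)
    moreover have "monom 1 (Suc nil_index) dvd pull_poly \<xi> (s * \<tau> ^ nil_index)" using sub s(3) by blast
    ultimately have "coeff (monom 1 nil_index * pull_poly \<xi> s) nil_index = 0"
      by (metis lessI monom_1_dvd_iff')
    then have "coeff (pull_poly \<xi> s) 0 = 0" by (simp add: coeff_monom_mult)
    moreover have "coeff (pull_poly \<xi> s) 0 = ev s"
      using pull_nth_0[OF s(1), of "\<lambda>j. fps_of_poly (\<xi> j)" x] base by (simp add: pull_fps_of_poly)
    ultimately show False using s(2) by simp
  qed
  then show thesis using that[of \<xi>] first base lower low residue by (simp add: less_Suc_eq_le)
qed

end

section \<open>The dimension of the local quotient\<close>

context regular_point_component
begin

abbreviation quot where "quot \<equiv> xring n Quot Q"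
abbreviation coset where "coset p \<equiv> Q +>\<^bsub>xring n\<^esub> p"
abbreviation scalars where "scalars \<equiv> range (\<lambda>c::'a. coset (mConst c))"

sublocale quot_hom: ring_hom_ring "xring n :: 'a pvpoly ring" quot "(+>\<^bsub>xring n\<^esub>) Q"
  using ideal.rcos_ring_hom_ring[OF ideal_Q] .

lemma coset_eq_iff:
  assumes "indets p \<subseteq> X ` {..<n}" "indets q \<subseteq> X ` {..<n}"
  shows "coset p = coset q \<longleftrightarrow> p - q \<in> Q"
proof -
  have "p \<ominus>\<^bsub>xring n\<^esub> q = p - q"
    using assms xring_uminus[of q n] by (simp add: a_minus_def)
  then show ?thesis
    using R.quotient_eq_iff_same_a_r_cos[OF ideal_Q, of p q] assms by simp
qed

lemma coset_hom:
  assumes "indets p \<subseteq> X ` {..<n}" "indets q \<subseteq> X ` {..<n}"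
  shows "coset p \<oplus>\<^bsub>quot\<^esub> coset q = coset (p + q)" "coset p \<otimes>\<^bsub>quot\<^esub> coset q = coset (p * q)"
  using quot_hom.hom_add[of p q] quot_hom.hom_mult[of p q] assms by simp_all

text \<open>The dimension is taken over the image of the constants, which is a field because the
  quotient is not the zero ring.\<close>

lemma subfield_scalars: "subfield scalars quot"
proof -
  let ?K = "range (mConst :: 'a \<Rightarrow> 'a pvpoly)"
  have mC: "mConst (a * b) = mConst a * (mConst b :: 'a pvpoly)" "mConst 1 = (1 :: 'a pvpoly)" for a b
    by (rule mc.hom_mult) (rule mc.hom_one)
  have K: "?K \<subseteq> carrier (xring n)" by auto
  have "subring ?K (xring n)"
  proof (rule R.subringI[OF K])
    fix h assume "h \<in> ?K"
    then show "\<ominus>\<^bsub>xring n\<^esub> h \<in> ?K"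
      using xring_uminus[of h n] by (auto simp flip: mc.hom_uminus)
  next
    show "\<one>\<^bsub>xring n\<^esub> \<in> ?K" by (rule range_eqI[where x = 1]) simp
  qed (auto simp flip: mc.hom_add mc.hom_mult)
  then have sub: "subcring ?K (xring n)" by (rule R.subcringI')
  have "Units (xring n \<lparr>carrier := ?K\<rparr>) = ?K - {0}"
  proof (intro equalityI subsetI)
    fix u assume "u \<in> Units (xring n \<lparr>carrier := ?K\<rparr>)"
    then show "u \<in> ?K - {0}" by (auto simp: Units_def)
  next
    fix u assume "u \<in> ?K - {0}"
    then obtain c where c: "u = mConst c" "mConst c \<noteq> (0 :: 'a pvpoly)" by auto
    then have "c \<noteq> 0" by auto
    then have "mConst (1 / c) * u = 1" "u * mConst (1 / c) = 1" by (simp_all add: c(1) flip: mC(1))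
    then show "u \<in> Units (xring n \<lparr>carrier := ?K\<rparr>)" using c by (auto simp: Units_def)
  qed
  then have "subfield ?K (xring n)" using R.subfieldI[OF sub] by simp
  moreover have "\<one>\<^bsub>quot\<^esub> \<noteq> \<zero>\<^bsub>quot\<^esub>"
  proof
    assume "\<one>\<^bsub>quot\<^esub> = \<zero>\<^bsub>quot\<^esub>"
    then have "coset 1 = coset 0" using quot_hom.hom_one quot_hom.hom_zero by simp
    then have "1 \<in> Q" using coset_eq_iff[of 1 0] by simp
    then show False using Q_vanishes[of 1] by simp
  qed
  ultimately have "subfield ((+>\<^bsub>xring n\<^esub>) Q ` ?K) quot" by (rule quot_hom.img_is_subfield(2))
  then show ?thesis by (simp add: image_image)
qed

lemma coset_in_carrier: "indets p \<subseteq> X ` {..<n} \<Longrightarrow> coset p \<in> carrier quot"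
  using quot_hom.hom_closed[of p] by simp

lemma combine_powers:
  "quot_hom.S.combine (map (\<lambda>c. coset (mConst c)) cs) (map (\<lambda>k. coset (\<tau> ^ (d + k))) [0..<length cs])
     = coset (\<tau> ^ d * at_\<tau> (Poly cs))"
proof (induction cs arbitrary: d)
  case Nil
  then show ?case using quot_hom.hom_zero by simp
next
  case (Cons c cs)
  have ks: "map (\<lambda>k. coset (\<tau> ^ (d + k))) [0..<length (c # cs)]
      = coset (\<tau> ^ d) # map (\<lambda>k. coset (\<tau> ^ (Suc d + k))) [0..<length cs]"
    by (simp add: upt_conv_Cons map_Suc_upt[symmetric] comp_def del: upt_Suc)
  have "indets (mConst c * \<tau> ^ d) \<subseteq> X ` {..<n}" "indets (\<tau> ^ Suc d * at_\<tau> (Poly cs)) \<subseteq> X ` {..<n}"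
    by (intro xring_closed indets_power indets_\<tau> indets_at_\<tau>; simp)+
  then have "coset (mConst c) \<otimes>\<^bsub>quot\<^esub> coset (\<tau> ^ d) \<oplus>\<^bsub>quot\<^esub> coset (\<tau> ^ Suc d * at_\<tau> (Poly cs))
      = coset (mConst c * \<tau> ^ d + \<tau> ^ Suc d * at_\<tau> (Poly cs))"
    using indets_power[OF indets_\<tau>] by (simp add: coset_hom)
  also have "mConst c * \<tau> ^ d + \<tau> ^ Suc d * at_\<tau> (Poly cs) = \<tau> ^ d * at_\<tau> (Poly (c # cs))"
    by (simp add: at_\<tau>_pCons algebra_simps)
  finally show ?case
    unfolding ks list.map quot_hom.S.combine.simps Cons.IH .
qed

text \<open>A list is built by prepending lower powers of \<open>\<tau>\<close>; a lower power is not a combination of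
  higher ones because \<open>at_\<tau>\<close> detects the lowest coefficient.\<close>

lemma independent_powers:
  "d + m = nil_index \<Longrightarrow>
     quot_hom.S.independent scalars (map (\<lambda>k. coset (\<tau> ^ (d + k))) [0..<m])"
proof (induction m arbitrary: d)
  case (Suc m)
  let ?Us = "map (\<lambda>k. coset (\<tau> ^ (Suc d + k))) [0..<m]"
  have Us: "set ?Us \<subseteq> carrier quot"
    using coset_in_carrier[OF indets_power[OF indets_\<tau>]] by (simp add: image_subset_iff del: power_Suc add_Suc)
  have "coset (\<tau> ^ d) \<notin> quot_hom.S.Span scalars ?Us"
  proof
    assume "coset (\<tau> ^ d) \<in> quot_hom.S.Span scalars ?Us"
    then obtain Ks where Ks: "set Ks \<subseteq> scalars" "length Ks = m" "coset (\<tau> ^ d) = quot_hom.S.combine Ks ?Us"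
      using quot_hom.S.Span_mem_iff_length_version[OF subfield_scalars Us] by auto
    then obtain cs where cs: "Ks = map (\<lambda>c. coset (mConst c)) cs"
      by (metis (no_types, lifting) ex_map_conv image_iff subset_iff)
    have "coset (\<tau> ^ d) = coset (\<tau> ^ Suc d * at_\<tau> (Poly cs))"
      using Ks combine_powers[of cs "Suc d"] unfolding cs by simp
    moreover have "\<tau> ^ d - \<tau> ^ Suc d * at_\<tau> (Poly cs) = at_\<tau> (monom 1 d * (1 - pCons 0 (Poly cs)))"
      by (simp add: at.hom_mult at.hom_minus at_\<tau>_monom at_\<tau>_pCons algebra_simps)
    moreover have "indets (\<tau> ^ d) \<subseteq> X ` {..<n}" "indets (\<tau> ^ Suc d * at_\<tau> (Poly cs)) \<subseteq> X ` {..<n}"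
      by (intro xring_closed indets_power indets_\<tau> indets_at_\<tau>)+
    ultimately have "at_\<tau> (monom 1 d * (1 - pCons 0 (Poly cs))) \<in> Q"
      by (metis coset_eq_iff)
    moreover have "coeff (monom 1 d * (1 - pCons 0 (Poly cs))) d = 1"
      by (simp add: coeff_monom_mult)
    ultimately show False using Suc.prems unfolding at_\<tau>_in_Q_iff by auto
  qed
  moreover have "coset (\<tau> ^ d) \<in> carrier quot" by (intro coset_in_carrier indets_power indets_\<tau>)
  moreover have "map (\<lambda>k. coset (\<tau> ^ (d + k))) [0..<Suc m] = coset (\<tau> ^ d) # ?Us"
    by (simp add: upt_conv_Cons map_Suc_upt[symmetric] comp_def del: upt_Suc)
  ultimately show ?case
    using Suc.IH[of "Suc d"] Suc.prems by (metis add_Suc_shift quot_hom.S.independent.li_Cons)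
qed simp

theorem dimension_quotient: "quot_hom.S.dimension nil_index scalars (carrier quot)"
proof -
  let ?Us = "map (\<lambda>k. coset (\<tau> ^ (0 + k))) [0..<nil_index]"
  have Us: "set ?Us \<subseteq> carrier quot"
    using coset_in_carrier[OF indets_power[OF indets_\<tau>]] by (simp add: image_subset_iff)
  obtain \<xi> where residue: "\<And>p. indets p \<subseteq> X ` {..<n} \<Longrightarrow> p - at_\<tau> (pull_poly \<xi> p) \<in> Q"
    using exists_arc_of_order_nil_index by metis
  have "carrier quot \<subseteq> quot_hom.S.Span scalars ?Us"
  proof
    fix u assume "u \<in> carrier quot"
    then obtain p where p: "u = coset p" "indets p \<subseteq> X ` {..<n}"
      by (auto simp: FactRing_def A_RCOSETS_def')
    define cs where "cs = map (coeff (pull_poly \<xi> p)) [0..<nil_index]"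
    have "at_\<tau> (pull_poly \<xi> p - Poly cs) \<in> Q"
      unfolding at_\<tau>_in_Q_iff by (simp add: cs_def nth_default_def)
    then have "p - at_\<tau> (Poly cs) \<in> Q"
      using Q_add[OF residue[OF p(2)]] by (fastforce simp: at.hom_minus)
    then have "u = coset (at_\<tau> (Poly cs))"
      using coset_eq_iff[OF p(2) indets_at_\<tau>] by (simp add: p(1))
    also have "\<dots> = quot_hom.S.combine (map (\<lambda>c. coset (mConst c)) cs) ?Us"
      using combine_powers[of cs 0] by (simp add: cs_def)
    finally show "u \<in> quot_hom.S.Span scalars ?Us"
      unfolding quot_hom.S.Span_mem_iff_length_version[OF subfield_scalars Us]
      by (intro exI[of _ "map (\<lambda>c. coset (mConst c)) cs"]) (auto simp: cs_def)
  qed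
  then have "quot_hom.S.Span scalars ?Us = carrier quot"
    using quot_hom.S.Span_in_carrier[OF _ Us] quot_hom.S.subring_props(1)[OF subfield_scalars] by blast
  then show ?thesis
    using quot_hom.S.dimension_independent[OF independent_powers[of 0 nil_index]] by simp
qed

corollary nil_index_unique: "quotient_dim n Q \<mu> \<Longrightarrow> nil_index = \<mu>"
  using quot_hom.S.dimension_is_inj[OF subfield_scalars dimension_quotient] unfolding quotient_dim_def by simp

end

section \<open>Regularity of the deflated system\<close>

text \<open>The linear coefficients along an arc are the Jacobian applied to the tangent vector, so they
  inherit a linear dependence of the rows. This excludes multiplicity one.\<close>

lemma pull_nth_1_first_row:
  fixes F :: "'a::field_char_0 pvpoly vec"
  assumes n: "n \<ge> 1" and F: "\<And>i. i < n \<Longrightarrow> indets (F $ i) \<subseteq> X ` {..<n}"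
    and arc_x: "\<And>j. j < n \<Longrightarrow> fps_nth (\<xi> j) 0 = x $ j"
    and row: "\<And>j. j < n \<Longrightarrow> meval (xpoint x) (mderiv (X j) (F $ 0))
        = (\<Sum>i \<in> {1..<n}. c i * meval (xpoint x) (mderiv (X j) (F $ i)))"
  shows "fps_nth (pull \<xi> (F $ 0)) 1 = (\<Sum>i \<in> {1..<n}. c i * fps_nth (pull \<xi> (F $ i)) 1)"
proof -
  have nth1: "fps_nth (pull \<xi> (F $ i)) 1
      = (\<Sum>j<n. fps_nth (\<xi> j) 1 * meval (xpoint x) (mderiv (X j) (F $ i)))" if "i < n" for i
  proof -
    have "fps_nth (pull \<xi> (mderiv (X j) (F $ i))) 0 = meval (xpoint x) (mderiv (X j) (F $ i))" for j
      using indets_mderiv[of "X j" "F $ i"] F[OF that] by (intro pull_nth_0 arc_x) auto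
    moreover have "fps_nth (pull \<xi> (F $ i)) 1 = fps_nth (fps_deriv (pull \<xi> (F $ i))) 0" by simp
    ultimately show ?thesis
      unfolding fps_deriv_pull[OF F[OF that]] by (simp add: fps_sum_nth)
  qed
  have "fps_nth (pull \<xi> (F $ 0)) 1
      = (\<Sum>j<n. \<Sum>i\<in>{1..<n}. c i * (fps_nth (\<xi> j) 1 * meval (xpoint x) (mderiv (X j) (F $ i))))"
    using nth1[of 0] n by (simp add: row sum_distrib_left mult.left_commute)
  also have "\<dots> = (\<Sum>i\<in>{1..<n}. c i * fps_nth (pull \<xi> (F $ i)) 1)"
    using nth1 by (subst sum.swap) (simp add: sum_distrib_left)
  finally show ?thesis .
qed

theorem theorem4p4:
  fixes n \<mu> :: nat
    and F :: "'a::field_char_0 pvpoly vec"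
    and x :: "'a vec"
  assumes n: "n \<ge> 1"
    and F: "F \<in> carrier_vec n" "\<forall>i<n. F $ i \<in> carrier (xring n)"
    and x: "x \<in> carrier_vec n"
    and mult: "isolated_root_mult n F x \<mu>"
    and corank: "corank (jacobian_at n F x) = 1"
    and first_row: "\<exists>c. row (jacobian_at n F x) 0 =
          vec n (\<lambda>j. \<Sum>i \<in> {1..<n}. c i * jacobian_at n F x $$ (i, j))"
    and first_col: "\<exists>c. col (jacobian_at n F x) 0 =
          vec n (\<lambda>i. \<Sum>j \<in> {1..<n}. c j * jacobian_at n F x $$ (i, j))"
  shows "vec_space.rank n
           (mat_of_cols n (map (col (jacobian_at n F x)) [1..<n] @ [unit_vec n 0])) = n \<and>
         (\<exists>!a. a \<in> a_values n \<mu> \<and> deflated_root n \<mu> F x (\<lambda>_. 0) a) \<and>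
         (\<forall>a \<in> a_values n \<mu>. deflated_root n \<mu> F x (\<lambda>_. 0) a \<longrightarrow>
            invertible_mat (map_mat (meval (point x (\<lambda>_. 0) a)) (deflated_jacobian n \<mu> F)))"
proof -
  let ?J = "jacobian_at n F x"
  have J: "?J \<in> carrier_mat n n" by (simp add: jacobian_at_def jacobian_def)
  have J_entry: "?J $$ (i, j) = meval (xpoint x) (mderiv (X j) (F $ i))" if "i < n" "j < n" for i j
    using that by (simp add: jacobian_at_def jacobian_def)
  have F': "indets (F $ i) \<subseteq> X ` {..<n}" if "i < n" for i using F(2) that by simp
  note F_carrier = F(1)
  have block: "lower_block n (\<lambda>i j. ?J $$ (i, j)) = lin_block n F x"
    unfolding lin_block_def lower_block_def by (rule eq_matI) (auto simp: J_entry)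
  have det_J: "det (lower_block n (\<lambda>i j. ?J $$ (i, j))) \<noteq> 0"
    by (rule corank1_lower_block[OF n J corank first_row first_col])
  then have det: "det (lin_block n F x) \<noteq> 0" unfolding block .
  obtain Q where Q: "isolated_primary_component (xring n) (system_ideal n F) (point_ideal n x) Q"
    "quotient_dim n Q \<mu>"
    using mult unfolding isolated_root_mult_def by blast
  interpret regular_point_component n F x Q
    by unfold_locales (use n F' Q(1) det in auto)
  have \<mu>: "nil_index = \<mu>" using nil_index_unique[OF Q(2)] .
  obtain \<xi> where \<xi>: "\<xi> 0 = [:x $ 0, 1:]" "\<And>j. j < n \<Longrightarrow> coeff (\<xi> j) 0 = x $ j"
    "\<And>i k. i \<in> {1..<n} \<Longrightarrow> k \<le> \<mu> \<Longrightarrow> coeff (pull_poly \<xi> (F $ i)) k = 0"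
    "\<And>k. k < \<mu> \<Longrightarrow> coeff (pull_poly \<xi> (F $ 0)) k = 0"
    "coeff (pull_poly \<xi> (F $ 0)) \<mu> \<noteq> 0"
    using exists_arc_of_order_nil_index unfolding \<mu> by metis
  let ?\<xi> = "\<lambda>j. fps_of_poly (\<xi> j)"
  have "\<mu> \<noteq> 1"
  proof
    assume "\<mu> = 1"
    obtain c where c: "row ?J 0 = vec n (\<lambda>j. \<Sum>i \<in> {1..<n}. c i * ?J $$ (i, j))"
      using first_row by blast
    have "meval (xpoint x) (mderiv (X j) (F $ 0))
        = (\<Sum>i \<in> {1..<n}. c i * meval (xpoint x) (mderiv (X j) (F $ i)))" if "j < n" for j
    proof -
      have "?J $$ (0, j) = row ?J 0 $ j" using J n that by simp
      then show ?thesis unfolding c using that n by (simp add: J_entry)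
    qed
    from pull_nth_1_first_row[of n F ?\<xi> x c, OF n F' _ this]
    have "fps_nth (pull ?\<xi> (F $ 0)) 1 = (\<Sum>i \<in> {1..<n}. c i * fps_nth (pull ?\<xi> (F $ i)) 1)"
      using \<xi>(2) by simp
    also have "\<dots> = 0"
      using \<xi>(3) \<open>\<mu> = 1\<close> by (intro sum.neutral) (simp add: pull_fps_of_poly)
    finally show False using \<xi>(5) \<open>\<mu> = 1\<close> by (simp add: pull_fps_of_poly)
  qed
  then have "\<mu> \<ge> 2" using nil_index_pos \<mu> by simp
  interpret solution_arc n \<mu> F x ?\<xi>
    by unfold_locales
       (use n F_carrier F' det \<open>\<mu> \<ge> 2\<close> \<xi> in \<open>auto simp: pull_fps_of_poly fps_of_poly_pCons\<close>)
  show ?thesis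
    using lower_block_imp_full_rank[OF n J det_J] deflated_root_unique deflated_jacobian_invertible
    by blast
qed

end
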